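(* For each integer $d \geq 3$, there exist a $(d+1)$-dimensional polytope $P \subset \mathbb{R}^{d+1}$ with $(2d+1)(d+1)+1$ facets and a nonzero linear objective function $\mathbf{w} \in \mathbb{R}^{d+1}$ such that for every nonzero $\mathbf{c} \in \mathbb{R}^{d+1}$ orthogonal to $\mathbf{w}$, the shadow simplex path from $\mathbf{w}$ to $\mathbf{c}$ on $P$ has length at least $2^{d-1}-1$.
   Context: The shadow simplex path from $\mathbf{w}$ to $\mathbf{c}$ on a polytope $P$ consists of the vertices of $P$ that are the unique maximizer over $P$ of $(\mathbf{w}+\lambda \mathbf{c})^{\top}\mathbf{x}$ for some $\lambda \geq 0$, in order of increasing $\lambda$ (if $\mathbf w,\mathbf c$ are not generic, ties may have to be broken, which can only add vertices to the path). Its length is the number of its edges, which is at least the number of such vertices minus one. *)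

theory Defs
  imports "HOL-Analysis.Analysis"
begin

section \<open>Shadow simplex paths\<close>

definition maximizers :: "'a::euclidean_space set \<Rightarrow> 'a \<Rightarrow> 'a set" where
  "maximizers P u = {x \<in> P. \<forall>y\<in>P. u \<bullet> y \<le> u \<bullet> x}"

definition shadow_vertices :: "'a::euclidean_space set \<Rightarrow> 'a \<Rightarrow> 'a \<Rightarrow> 'a set" where
  "shadow_vertices P w c = {v. \<exists>\<mu>\<ge>0. maximizers P (w + \<mu> *\<^sub>R c) = {v}}"

text \<open>
  A shadow path is the vertex sequence traced by the parametric simplex method when the
  objective \<open>w + \<tau> c\<close> moves from \<open>\<tau> = 0\<close> to infinity. The \<open>i\<close>-th vertex is optimal on
  \<open>[\<tau> i, \<tau> (i + 1)]\<close> (the last one on \<open>[\<tau> k, \<infinity>)\<close>), and at the breakpoint \<open>\<tau> (i + 1)\<close> the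
  path moves to the next vertex along an edge of \<open>P\<close> all of whose points are then optimal.
  For generic \<open>w\<close> and \<open>c\<close> this is the sequence of the \<open>shadow_vertices\<close>. Otherwise several edges
  may be used at one breakpoint and the path depends on how ties are broken, but a shadow path
  always exists and each one contains all \<open>shadow_vertices\<close>. These facts are proved below.
\<close>

definition shadow_path ::
    "'a::euclidean_space set \<Rightarrow> 'a \<Rightarrow> 'a \<Rightarrow> 'a list \<Rightarrow> bool" where
  "shadow_path P w c vs \<longleftrightarrow>
     vs \<noteq> [] \<and> distinct vs \<and> (\<forall>v\<in>set vs. v extreme_point_of P) \<and>
     (\<exists>\<tau>::nat \<Rightarrow> real. \<tau> 0 = 0 \<and>
        hd vs \<in> maximizers P w \<and>
        (\<forall>i. Suc i < length vs \<longrightarrow>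
           \<tau> i \<le> \<tau> (Suc i) \<and>
           closed_segment (vs ! i) (vs ! Suc i) edge_of P \<and>
           closed_segment (vs ! i) (vs ! Suc i) \<subseteq> maximizers P (w + \<tau> (Suc i) *\<^sub>R c) \<and>
           c \<bullet> (vs ! i) \<le> c \<bullet> (vs ! Suc i)) \<and>
        (\<forall>\<mu>\<ge>\<tau> (length vs - 1). last vs \<in> maximizers P (w + \<mu> *\<^sub>R c)))"

definition path_length :: "'a list \<Rightarrow> nat" where
  "path_length vs = length vs - 1"


section \<open>Every shadow path contains the shadow vertices\<close>

lemma maximizers_between:
  assumes "v \<in> maximizers P (w + a *\<^sub>R c)" "v \<in> maximizers P (w + b *\<^sub>R c)" "a \<le> \<mu>" "\<mu> \<le> b"
  shows "v \<in> maximizers P (w + \<mu> *\<^sub>R c)"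
proof (cases "a = b")
  case True
  then show ?thesis using assms by auto
next
  case False
  then have ab: "b - a > 0" using assms by auto
  have "(w + \<mu> *\<^sub>R c) \<bullet> y \<le> (w + \<mu> *\<^sub>R c) \<bullet> v" if "y \<in> P" for y
  proof -
    have 1: "(b - \<mu>) * ((w + a *\<^sub>R c) \<bullet> y) \<le> (b - \<mu>) * ((w + a *\<^sub>R c) \<bullet> v)"
      using assms that by (intro mult_left_mono) (auto simp: maximizers_def)
    have 2: "(\<mu> - a) * ((w + b *\<^sub>R c) \<bullet> y) \<le> (\<mu> - a) * ((w + b *\<^sub>R c) \<bullet> v)"
      using assms that by (intro mult_left_mono) (auto simp: maximizers_def)
    have e: "(b - \<mu>) * ((w + a *\<^sub>R c) \<bullet> z) + (\<mu> - a) * ((w + b *\<^sub>R c) \<bullet> z)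
           = (b - a) * ((w + \<mu> *\<^sub>R c) \<bullet> z)" for z
      by (simp add: inner_simps algebra_simps)
    have "(b - a) * ((w + \<mu> *\<^sub>R c) \<bullet> y) \<le> (b - a) * ((w + \<mu> *\<^sub>R c) \<bullet> v)"
      using 1 2 e[of y] e[of v] by linarith
    then show ?thesis using ab by simp
  qed
  then show ?thesis using assms by (auto simp: maximizers_def)
qed

lemma shadow_path_covers:
  assumes "shadow_path P w c vs" "\<mu> \<ge> 0"
  shows "\<exists>v\<in>set vs. v \<in> maximizers P (w + \<mu> *\<^sub>R c)"
proof -
  obtain l where ne: "vs \<noteq> []" and l0: "l 0 = 0" and hd: "hd vs \<in> maximizers P w"
    and step: "\<And>i. Suc i < length vs \<Longrightarrow> l i \<le> l (Suc i) \<and>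
           closed_segment (vs ! i) (vs ! Suc i) \<subseteq> maximizers P (w + l (Suc i) *\<^sub>R c)"
    and last: "\<And>\<nu>. \<nu> \<ge> l (length vs - 1) \<Longrightarrow> last vs \<in> maximizers P (w + \<nu> *\<^sub>R c)"
    using assms(1) unfolding shadow_path_def by (elim conjE exE) blast
  have at: "vs ! i \<in> maximizers P (w + l i *\<^sub>R c)" if "i < length vs" for i
  proof (cases i)
    case 0
    then show ?thesis using hd ne l0 by (simp add: hd_conv_nth)
  next
    case (Suc j)
    then show ?thesis using step[of j] that by auto
  qed
  show ?thesis
  proof (cases "\<mu> \<ge> l (length vs - 1)")
    case True
    then show ?thesis using last[OF True] last_in_set[OF ne] by blast
  next
    case False
    define n where "n = (LEAST n. \<mu> \<le> l n)"
    have n: "\<mu> \<le> l n" "n \<le> length vs - 1"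
      unfolding n_def by (rule LeastI[of _ "length vs - 1"], use False in simp)
        (rule Least_le, use False in simp)
    show ?thesis
    proof (cases n)
      case 0
      then have "\<mu> = 0" using n l0 assms by auto
      then show ?thesis using hd ne by auto
    next
      case (Suc j)
      have "\<not> \<mu> \<le> l j" using not_less_Least[of j "\<lambda>n. \<mu> \<le> l n"] Suc n_def by auto
      moreover have j: "Suc j < length vs" using n Suc ne by (cases vs) auto
      moreover have "vs ! j \<in> maximizers P (w + l j *\<^sub>R c)" using at j by simp
      moreover have "vs ! j \<in> maximizers P (w + l (Suc j) *\<^sub>R c)"
        using step[OF j] ends_in_segment(1) by blast
      ultimately have "vs ! j \<in> maximizers P (w + \<mu> *\<^sub>R c)"
        using n(1) unfolding Suc by (metis maximizers_between linear)
      moreover have "vs ! j \<in> set vs" using j by simp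
      ultimately show ?thesis by blast
    qed
  qed
qed

lemma shadow_path_contains_shadow_vertices:
  assumes "shadow_path P w c vs"
  shows "shadow_vertices P w c \<subseteq> set vs"
proof
  fix v assume "v \<in> shadow_vertices P w c"
  then obtain \<mu> where "\<mu> \<ge> 0" "maximizers P (w + \<mu> *\<^sub>R c) = {v}"
    unfolding shadow_vertices_def by blast
  then show "v \<in> set vs" using shadow_path_covers[OF assms, of \<mu>] by auto
qed

lemma shadow_path_length_ge:
  assumes "shadow_path P w c vs"
  shows "card (shadow_vertices P w c) - 1 \<le> path_length vs"
proof -
  have "card (shadow_vertices P w c) \<le> card (set vs)"
    by (intro card_mono shadow_path_contains_shadow_vertices[OF assms]) simp
  then show ?thesis using card_length[of vs] unfolding path_length_def by linarith
qed


section \<open>Shadow paths exist\<close>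

lemma maximizers_face_of:
  assumes "convex P"
  shows "maximizers P u face_of P"
proof (cases "maximizers P u = {}")
  case False
  then obtain z where z: "z \<in> maximizers P u" by auto
  then have "maximizers P u = P \<inter> {x. u \<bullet> x = u \<bullet> z}"
    by (force simp: maximizers_def)
  then show ?thesis
    using face_of_Int_supporting_hyperplane_le[OF assms, of u "u \<bullet> z"] z
    by (auto simp: maximizers_def)
qed auto

lemma small_step:
  fixes f g :: "'i \<Rightarrow> real"
  assumes "finite I" "\<And>i. i \<in> I \<Longrightarrow> f i > 0"
  obtains \<epsilon> where "\<epsilon> > 0" "\<epsilon> \<le> 1" "\<And>i s. i \<in> I \<Longrightarrow> \<bar>s\<bar> \<le> \<epsilon> \<Longrightarrow> s * g i \<le> f i"
proof -
  have "\<exists>\<epsilon>>0. \<epsilon> \<le> 1 \<and> (\<forall>i\<in>I. \<forall>s. \<bar>s\<bar> \<le> \<epsilon> \<longrightarrow> s * g i \<le> f i)"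
    using assms
  proof (induction I rule: finite_induct)
    case empty
    then show ?case by (intro exI[of _ 1]) auto
  next
    case (insert j I)
    then obtain e where e: "e > 0" "e \<le> 1" "\<forall>i\<in>I. \<forall>s. \<bar>s\<bar> \<le> e \<longrightarrow> s * g i \<le> f i" by auto
    have fj: "f j > 0" using insert by auto
    define e' where "e' = min e (f j / (\<bar>g j\<bar> + 1))"
    have "s * g j \<le> f j" if "\<bar>s\<bar> \<le> e'" for s
    proof -
      have "s * g j \<le> \<bar>s\<bar> * (\<bar>g j\<bar> + 1)"
        using abs_ge_self[of "s * g j"] by (simp add: abs_mult distrib_left add_increasing2)
      also have "\<dots> \<le> f j / (\<bar>g j\<bar> + 1) * (\<bar>g j\<bar> + 1)"
        using that by (intro mult_right_mono) (auto simp: e'_def)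
      also have "\<dots> = f j" using abs_ge_zero[of "g j"] by (simp add: nonzero_divide_eq_eq)
      finally show ?thesis .
    qed
    moreover have "e' > 0" "e' \<le> 1" using e fj by (auto simp: e'_def)
    ultimately show ?case using e by (intro exI[of _ e']) (auto simp: e'_def)
  qed
  then show ?thesis using that by blast
qed

lemma improving_proper_face:
  fixes P :: "'a::euclidean_space set"
  assumes P: "polytope P" and v: "v extreme_point_of P" and x: "x \<in> P" "c \<bullet> v < c \<bullet> x"
    and nc: "\<not> collinear P"
  obtains F z where "F face_of P" "F \<noteq> P" "v \<in> F" "z \<in> F" "c \<bullet> v < c \<bullet> z"
proof -
  have vP: "v \<in> P" using v by (simp add: extreme_point_of_def)
  obtain y where y: "y \<in> P" "y \<notin> affine hull {v, x}"
    using nc by (meson collinear_affine_hull subsetI)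
  define k where "k = (c \<bullet> (y - v)) / (c \<bullet> (x - v))"
  define u where "u = (y - v) - k *\<^sub>R (x - v)"
  have cu: "c \<bullet> u = 0"
    using x by (simp add: u_def k_def inner_simps)
  have u0: "u \<noteq> 0"
  proof
    assume "u = 0"
    then have "y = (1 - k) *\<^sub>R v + k *\<^sub>R x" by (simp add: u_def algebra_simps)
    then have "y \<in> affine hull {v, x}" unfolding affine_hull_2
      by (intro CollectI exI[of _ "1 - k"] exI[of _ k]) auto
    then show False using y by auto
  qed
  have upar: "a \<bullet> u = 0" if "P \<subseteq> {p. a \<bullet> p = b}" for a and b :: real
    using that vP x y by (auto simp: u_def inner_simps subset_iff)
  obtain H where H: "finite H" "P = \<Inter>H" "\<forall>h\<in>H. \<exists>a b. a \<noteq> 0 \<and> h = {x. a \<bullet> x \<le> b}"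
    using polytope_imp_polyhedron[OF P] unfolding polyhedron_def by auto
  then obtain a b where ab: "\<And>h. h \<in> H \<Longrightarrow> h = {x. a h \<bullet> x \<le> b h}"
    by metis
  have inP: "p \<in> P \<longleftrightarrow> (\<forall>h\<in>H. a h \<bullet> p \<le> b h)" for p
    using H(2) ab by blast
  define A where "A = {h \<in> H. a h \<bullet> v = b h}"
  have A: "finite A" "A \<subseteq> H" using H by (auto simp: A_def)
  have move: "\<exists>\<epsilon>>0. \<epsilon> \<le> 1 \<and> (\<forall>s. \<bar>s\<bar> \<le> \<epsilon> \<longrightarrow> (\<forall>h\<in>H-A. a h \<bullet> (v + s *\<^sub>R q) \<le> b h))" for q
  proof -
    have "b h - a h \<bullet> v > 0" if "h \<in> H - A" for h
      using that vP inP by (auto simp: A_def order_less_le)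
    then obtain \<epsilon> where e: "\<epsilon> > 0" "\<epsilon> \<le> 1"
        "\<And>h s. h \<in> H - A \<Longrightarrow> \<bar>s\<bar> \<le> \<epsilon> \<Longrightarrow> s * (a h \<bullet> q) \<le> b h - a h \<bullet> v"
      using small_step[of "H - A" "\<lambda>h. b h - a h \<bullet> v" "\<lambda>h. a h \<bullet> q"] H(1) by (metis finite_Diff)
    have "a h \<bullet> (v + s *\<^sub>R q) \<le> b h" if "\<bar>s\<bar> \<le> \<epsilon>" "h \<in> H - A" for s h
      using e(3)[OF that(2,1)] by (simp add: inner_simps)
    then show ?thesis using e(1,2) by blast
  qed
  have "\<exists>h\<in>A. a h \<bullet> u \<noteq> 0"
  proof (rule ccontr)
    assume n: "\<not> ?thesis"
    obtain \<epsilon> where e: "\<epsilon> > 0" "\<And>s. \<bar>s\<bar> \<le> \<epsilon> \<Longrightarrow> (\<forall>h\<in>H-A. a h \<bullet> (v + s *\<^sub>R u) \<le> b h)"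
      using move[of u] by blast
    have "v + s *\<^sub>R u \<in> P" if "\<bar>s\<bar> \<le> \<epsilon>" for s
      unfolding inP using e(2)[OF that] n by (auto simp: inner_simps A_def)
    from this[of \<epsilon>] this[of "-\<epsilon>"] e(1)
    have "v + \<epsilon> *\<^sub>R u \<in> P" "v - \<epsilon> *\<^sub>R u \<in> P" by auto
    moreover have "v \<in> open_segment (v + \<epsilon> *\<^sub>R u) (v - \<epsilon> *\<^sub>R u)"
    proof -
      have "v + \<epsilon> *\<^sub>R u \<noteq> v - \<epsilon> *\<^sub>R u"
      proof
        assume "v + \<epsilon> *\<^sub>R u = v - \<epsilon> *\<^sub>R u"
        then have "(2 * \<epsilon>) *\<^sub>R u = 0" by (simp add: algebra_simps flip: scaleR_2)
        then show False using e(1) u0 by simp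
      qed
      moreover have "midpoint (v + \<epsilon> *\<^sub>R u) (v - \<epsilon> *\<^sub>R u) = v"
        by (simp add: midpoint_def flip: scaleR_2)
      ultimately show ?thesis by (metis midpoint_in_open_segment)
    qed
    ultimately show False using v by (auto simp: extreme_point_of_def)
  qed
  then obtain h1 where h1: "h1 \<in> A" "a h1 \<bullet> u \<noteq> 0" by blast
  define \<sigma> where "\<sigma> = sgn (a h1 \<bullet> u)"
  have sg: "\<exists>h\<in>A. a h \<bullet> (\<sigma> *\<^sub>R u) > 0"
    using h1 by (intro bexI[of _ h1]) (auto simp: \<sigma>_def sgn_if)
  define u' where "u' = \<sigma> *\<^sub>R u"
  define B where "B = {h \<in> A. a h \<bullet> u' > 0}"
  define t where "t h = (b h - a h \<bullet> x) / (a h \<bullet> u')" for h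
  have B: "finite B" "B \<noteq> {}" using A sg by (auto simp: B_def u'_def)
  obtain h0 where h0: "h0 \<in> B" "\<And>h. h \<in> B \<Longrightarrow> t h0 \<le> t h"
    using arg_min_if_finite(1)[OF B, of t] arg_min_least[OF B, of _ t] by blast
  have t0: "t h0 \<ge> 0"
    using h0(1) x(1) inP A by (auto simp: t_def B_def)
  define z where "z = x + t h0 *\<^sub>R u'"
  have cz: "c \<bullet> z = c \<bullet> x" by (simp add: z_def u'_def inner_simps cu)
  have z0: "a h0 \<bullet> z = b h0" using h0 by (simp add: z_def t_def inner_simps B_def)
  have zA: "a h \<bullet> z \<le> b h" if "h \<in> A" for h
  proof (cases "h \<in> B")
    case True
    then have "a h \<bullet> u' > 0" by (simp add: B_def)
    moreover have "t h0 \<le> t h" using h0 True by auto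
    ultimately have "t h0 * (a h \<bullet> u') \<le> b h - a h \<bullet> x" by (simp add: t_def pos_le_divide_eq)
    then show ?thesis by (simp add: z_def inner_simps)
  next
    case False
    then have "a h \<bullet> u' \<le> 0" using that by (auto simp: B_def)
    then have "t h0 * (a h \<bullet> u') \<le> 0" using t0 by (simp add: mult_nonneg_nonpos)
    moreover have "a h \<bullet> x \<le> b h" using x(1) inP A that by auto
    ultimately show ?thesis by (simp add: z_def inner_simps)
  qed
  obtain \<epsilon> where e: "\<epsilon> > 0" "\<epsilon> \<le> 1" "\<forall>h\<in>H-A. a h \<bullet> (v + \<epsilon> *\<^sub>R (z - v)) \<le> b h"
    using move[of "z - v"] by (metis abs_of_pos order_refl)
  define p where "p = v + \<epsilon> *\<^sub>R (z - v)"
  have pv: "q \<bullet> p = q \<bullet> v + \<epsilon> * (q \<bullet> z - q \<bullet> v)" for q by (simp add: p_def inner_simps)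
  have pA: "a h \<bullet> p \<le> b h" if "h \<in> A" for h
    using zA[OF that] that e(1,2) by (auto simp: pv A_def mult_nonneg_nonpos)
  then have pP: "p \<in> P" unfolding inP using e(3) p_def by blast
  have h0A: "h0 \<in> A" using h0 B_def by auto
  have p0: "a h0 \<bullet> p = b h0" using z0 h0A by (simp add: pv A_def)
  have cp: "c \<bullet> v < c \<bullet> p" using e x by (simp add: pv cz)
  let ?F = "P \<inter> {q. a h0 \<bullet> q = b h0}"
  have "?F face_of P"
    using h0A A inP by (intro face_of_Int_supporting_hyperplane_le polytope_imp_convex[OF P]) auto
  moreover have "?F \<noteq> P"
  proof
    assume "?F = P"
    then have "a h0 \<bullet> u = 0" using upar[of "a h0" "b h0"] by blast
    then show False using h0 by (auto simp: B_def u'_def)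
  qed
  moreover have "v \<in> ?F" using vP h0A by (auto simp: A_def)
  moreover have "p \<in> ?F" using pP p0 by auto
  ultimately show ?thesis using cp that by blast
qed

lemma improving_edge:
  fixes P :: "'a::euclidean_space set"
  assumes "polytope P" "v extreme_point_of P" "x \<in> P" "c \<bullet> v < c \<bullet> x"
  shows "\<exists>v'. v' extreme_point_of P \<and> closed_segment v v' edge_of P \<and> c \<bullet> v < c \<bullet> v'"
  using assms
proof (induction "nat (aff_dim P + 1)" arbitrary: P x rule: less_induct)
  case less
  have vP: "v \<in> P" using less by (simp add: extreme_point_of_def)
  show ?case
  proof (cases "collinear P")
    case True
    then obtain p q where pq: "P = closed_segment p q"
      using compact_convex_collinear_segment[of P] vP polytope_imp_compact polytope_imp_convex
        less.prems by blast
    then obtain v' where v': "P = closed_segment v v'" "v' extreme_point_of P"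
      using less.prems(2) by (metis closed_segment_commute extreme_point_of_segment)
    have "c \<bullet> v < c \<bullet> v'"
    proof (rule ccontr)
      assume n: "\<not> ?thesis"
      obtain s where s: "0 \<le> s" "x = (1 - s) *\<^sub>R v + s *\<^sub>R v'"
        using less.prems v' by (auto simp: in_segment)
      have "c \<bullet> x = c \<bullet> v + s * (c \<bullet> v' - c \<bullet> v)"
        by (simp add: s inner_simps algebra_simps)
      then show False using less.prems(4) n mult_nonneg_nonpos[OF s(1), of "c \<bullet> v' - c \<bullet> v"] by linarith
    qed
    moreover then have "aff_dim P = 1"
      unfolding v' by (metis aff_dim_2 aff_dim_convex_hull less_irrefl segment_convex_hull)
    ultimately show ?thesis
      using v' less.prems polytope_imp_convex unfolding edge_of_def
      by (metis face_of_refl)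
  next
    case False
    obtain F z where F: "F face_of P" "F \<noteq> P" "v \<in> F" "z \<in> F" "c \<bullet> v < c \<bullet> z"
      using improving_proper_face[OF less.prems False] by blast
    have "aff_dim F < aff_dim P"
      using face_of_aff_dim_lt F less.prems polytope_imp_convex by blast
    moreover have "aff_dim F \<ge> 0" using F(3) aff_dim_geq[of F] aff_dim_empty[of F] by fastforce
    ultimately obtain v' where v': "v' extreme_point_of F" "closed_segment v v' edge_of F"
        "c \<bullet> v < c \<bullet> v'"
      using less.hyps[of F z] face_of_polytope_polytope[OF less.prems(1) F(1)]
        extreme_point_of_face[OF F(1)] less.prems F by auto
    then show ?thesis
      using extreme_point_of_face[OF F(1)] face_of_trans[OF _ F(1)] unfolding edge_of_def by blast
  qed
qed

lemma polytope_inner_le: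
  fixes P :: "'a::euclidean_space set"
  assumes "polytope P" "\<And>u. u extreme_point_of P \<Longrightarrow> q \<bullet> u \<le> m" "y \<in> P"
  shows "q \<bullet> y \<le> m"
proof -
  have "P = convex hull {u. u extreme_point_of P}"
    using assms(1) Krein_Milman_Minkowski polytope_imp_compact polytope_imp_convex by blast
  also have "\<dots> \<subseteq> {x. q \<bullet> x \<le> m}"
    using assms(2) by (intro hull_minimal convex_halfspace_le) auto
  finally show ?thesis using assms(3) by auto
qed

lemma finite_polytope_extreme_points:
  fixes P :: "'a::euclidean_space set"
  shows "polytope P \<Longrightarrow> finite {u. u extreme_point_of P}"
  by (simp add: finite_polyhedron_extreme_points polytope_imp_polyhedron)

lemma maximizers_upward:
  assumes "v \<in> maximizers P (w + \<mu> *\<^sub>R c)" "\<And>y. y \<in> P \<Longrightarrow> c \<bullet> y \<le> c \<bullet> v" "\<mu> \<le> \<nu>"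
  shows "v \<in> maximizers P (w + \<nu> *\<^sub>R c)"
proof -
  have "(w + \<nu> *\<^sub>R c) \<bullet> y \<le> (w + \<nu> *\<^sub>R c) \<bullet> v" if "y \<in> P" for y
  proof -
    have "(w + \<mu> *\<^sub>R c) \<bullet> y \<le> (w + \<mu> *\<^sub>R c) \<bullet> v"
      using assms(1) that by (auto simp: maximizers_def)
    moreover have "(\<nu> - \<mu>) * (c \<bullet> y) \<le> (\<nu> - \<mu>) * (c \<bullet> v)"
      using assms(2)[OF that] assms(3) by (intro mult_left_mono) auto
    ultimately show ?thesis by (simp add: inner_simps algebra_simps)
  qed
  then show ?thesis using assms(1) by (auto simp: maximizers_def)
qed

lemma next_breakpoint:
  fixes P :: "'a::euclidean_space set"
  assumes P: "polytope P" and v: "v extreme_point_of P" "v \<in> maximizers P (w + \<mu> *\<^sub>R c)"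
    and x: "x \<in> P" "c \<bullet> v < c \<bullet> x"
  obtains \<nu> v' where "\<mu> \<le> \<nu>" "v' extreme_point_of P" "closed_segment v v' edge_of P"
    "closed_segment v v' \<subseteq> maximizers P (w + \<nu> *\<^sub>R c)" "c \<bullet> v < c \<bullet> v'"
proof -
  define U where "U = {u. u extreme_point_of P \<and> c \<bullet> v < c \<bullet> u}"
  have "\<exists>u. u extreme_point_of P \<and> c \<bullet> v < c \<bullet> u"
    using polytope_inner_le[OF P, of c "c \<bullet> v" x] x by force
  then have U: "finite U" "U \<noteq> {}"
    using finite_polytope_extreme_points[OF P] by (auto simp: U_def)
  define r where "r u = (w \<bullet> v - w \<bullet> u) / (c \<bullet> u - c \<bullet> v)" for u
  obtain u0 where u0: "u0 \<in> U" "\<And>u. u \<in> U \<Longrightarrow> r u0 \<le> r u"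
    using arg_min_if_finite(1)[OF U, of r] arg_min_least[OF U, of _ r] by blast
  define \<nu> where "\<nu> = r u0"
  have vm: "(w + \<mu> *\<^sub>R c) \<bullet> y \<le> (w + \<mu> *\<^sub>R c) \<bullet> v" if "y \<in> P" for y
    using v(2) that by (auto simp: maximizers_def)
  have le: "\<mu> \<le> \<nu>"
  proof -
    have "u0 \<in> P" "c \<bullet> u0 - c \<bullet> v > 0" using u0(1) by (auto simp: U_def extreme_point_of_def)
    then show ?thesis using vm[of u0]
      by (simp add: \<nu>_def r_def pos_le_divide_eq inner_simps algebra_simps)
  qed
  have "(w + \<nu> *\<^sub>R c) \<bullet> u \<le> (w + \<nu> *\<^sub>R c) \<bullet> v" if u: "u extreme_point_of P" for u
  proof (cases "u \<in> U")
    case True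
    then have "c \<bullet> u - c \<bullet> v > 0" "\<nu> \<le> r u" using u0(2) by (auto simp: U_def \<nu>_def)
    then have "\<nu> * (c \<bullet> u - c \<bullet> v) \<le> w \<bullet> v - w \<bullet> u" by (simp add: r_def pos_le_divide_eq)
    then show ?thesis by (simp add: inner_simps algebra_simps)
  next
    case False
    then have "c \<bullet> u \<le> c \<bullet> v" using u by (auto simp: U_def)
    then have "(\<nu> - \<mu>) * (c \<bullet> u) \<le> (\<nu> - \<mu>) * (c \<bullet> v)"
      using le by (intro mult_left_mono) auto
    moreover have "(w + \<mu> *\<^sub>R c) \<bullet> u \<le> (w + \<mu> *\<^sub>R c) \<bullet> v"
      using vm u by (auto simp: extreme_point_of_def)
    ultimately show ?thesis by (simp add: inner_simps algebra_simps)
  qed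
  then have vn: "v \<in> maximizers P (w + \<nu> *\<^sub>R c)"
    using polytope_inner_le[OF P] v(1) by (auto simp: maximizers_def extreme_point_of_def)
  have "c \<bullet> u0 - c \<bullet> v > 0" using u0(1) by (simp add: U_def)
  then have "\<nu> * (c \<bullet> u0 - c \<bullet> v) = w \<bullet> v - w \<bullet> u0" by (simp add: \<nu>_def r_def)
  then have "(w + \<nu> *\<^sub>R c) \<bullet> u0 = (w + \<nu> *\<^sub>R c) \<bullet> v" by (simp add: inner_simps algebra_simps)
  then have u0n: "u0 \<in> maximizers P (w + \<nu> *\<^sub>R c)"
    using vn u0(1) by (auto simp: maximizers_def U_def extreme_point_of_def)
  let ?F = "maximizers P (w + \<nu> *\<^sub>R c)"
  have F: "?F face_of P" by (intro maximizers_face_of polytope_imp_convex P)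
  obtain v' where v': "v' extreme_point_of ?F" "closed_segment v v' edge_of ?F" "c \<bullet> v < c \<bullet> v'"
    using improving_edge[OF face_of_polytope_polytope[OF P F], of v u0 c] u0n u0(1) vn v(1)
      extreme_point_of_face[OF F] by (auto simp: U_def)
  show ?thesis
  proof
    show "closed_segment v v' edge_of P"
      using v'(2) face_of_trans[OF _ F] unfolding edge_of_def by blast
  qed (use le v' edge_of_imp_subset extreme_point_of_face[OF F] in auto)
qed

lemma shadow_path_from:
  fixes P :: "'a::euclidean_space set"
  assumes P: "polytope P" and v: "v extreme_point_of P" "v \<in> maximizers P (w + \<mu> *\<^sub>R c)"
  shows "\<exists>vs \<tau>. vs \<noteq> [] \<and> hd vs = v \<and> (\<forall>u\<in>set vs. u extreme_point_of P) \<and>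
           sorted_wrt (\<lambda>x y. c \<bullet> x < c \<bullet> y) vs \<and> \<tau> (0::nat) = \<mu> \<and>
           (\<forall>i. Suc i < length vs \<longrightarrow> \<tau> i \<le> \<tau> (Suc i) \<and>
              closed_segment (vs ! i) (vs ! Suc i) edge_of P \<and>
              closed_segment (vs ! i) (vs ! Suc i) \<subseteq> maximizers P (w + \<tau> (Suc i) *\<^sub>R c)) \<and>
           (\<forall>\<nu>\<ge>\<tau> (length vs - 1). last vs \<in> maximizers P (w + \<nu> *\<^sub>R c))"
  using v
proof (induction "card {u. u extreme_point_of P \<and> c \<bullet> v < c \<bullet> u}" arbitrary: v \<mu> rule: less_induct)
  case less
  show ?case
  proof (cases "\<exists>x\<in>P. c \<bullet> v < c \<bullet> x")
    case False
    then have "\<forall>\<nu>\<ge>\<mu>. v \<in> maximizers P (w + \<nu> *\<^sub>R c)"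
      using maximizers_upward[OF less.prems(2)] by (metis linorder_not_less)
    then show ?thesis using less.prems by (intro exI[of _ "[v]"] exI[of _ "\<lambda>_. \<mu>"]) auto
  next
    case True
    then obtain \<nu> v' where n: "\<mu> \<le> \<nu>" "v' extreme_point_of P" "closed_segment v v' edge_of P"
      "closed_segment v v' \<subseteq> maximizers P (w + \<nu> *\<^sub>R c)" "c \<bullet> v < c \<bullet> v'"
      using next_breakpoint[OF P less.prems] by blast
    have fin: "finite {u. u extreme_point_of P \<and> c \<bullet> v < c \<bullet> u}"
      using finite_polytope_extreme_points[OF P] by simp
    have "{u. u extreme_point_of P \<and> c \<bullet> v' < c \<bullet> u} \<subset> {u. u extreme_point_of P \<and> c \<bullet> v < c \<bullet> u}"
      using n by force
    then have "card {u. u extreme_point_of P \<and> c \<bullet> v' < c \<bullet> u}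
        < card {u. u extreme_point_of P \<and> c \<bullet> v < c \<bullet> u}"
      using psubset_card_mono[OF fin] by blast
    moreover have "v' \<in> maximizers P (w + \<nu> *\<^sub>R c)" using n by auto
    ultimately obtain vs \<tau> where vs: "vs \<noteq> []" "hd vs = v'" "\<forall>u\<in>set vs. u extreme_point_of P"
      "sorted_wrt (\<lambda>x y. c \<bullet> x < c \<bullet> y) vs" "\<tau> (0::nat) = \<nu>"
      and st: "\<forall>i. Suc i < length vs \<longrightarrow> \<tau> i \<le> \<tau> (Suc i) \<and>
              closed_segment (vs ! i) (vs ! Suc i) edge_of P \<and>
              closed_segment (vs ! i) (vs ! Suc i) \<subseteq> maximizers P (w + \<tau> (Suc i) *\<^sub>R c)"
      and la: "\<forall>\<nu>\<ge>\<tau> (length vs - 1). last vs \<in> maximizers P (w + \<nu> *\<^sub>R c)"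
      using less.hyps[of v' \<nu>] n(2) by blast
    define \<tau>' where "\<tau>' = case_nat \<mu> \<tau>"
    have t': "\<tau>' 0 = \<mu>" "\<And>i. \<tau>' (Suc i) = \<tau> i" by (auto simp: \<tau>'_def)
    have v'0: "vs ! 0 = v'" using vs by (simp add: hd_conv_nth)
    have "\<forall>u\<in>set vs. c \<bullet> v < c \<bullet> u"
      using vs(1,2,4) n(5) by (cases vs) (auto intro: less_trans)
    moreover have "\<tau>' i \<le> \<tau>' (Suc i) \<and>
              closed_segment ((v # vs) ! i) ((v # vs) ! Suc i) edge_of P \<and>
              closed_segment ((v # vs) ! i) ((v # vs) ! Suc i) \<subseteq> maximizers P (w + \<tau>' (Suc i) *\<^sub>R c)"
      if "Suc i < length (v # vs)" for i
    proof (cases i)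
      case 0
      then show ?thesis using n vs v'0 by (simp add: t')
    next
      case (Suc j)
      then show ?thesis using st[rule_format, of j] that by (simp add: t')
    qed
    moreover have "\<tau>' (length (v # vs) - 1) = \<tau> (length vs - 1)"
      using vs(1) by (cases vs) (auto simp: t')
    ultimately show ?thesis
      using vs la less.prems(1) by (intro exI[of _ "v # vs"] exI[of _ \<tau>']) (auto simp: t'(1))
  qed
qed

theorem shadow_path_exists:
  fixes P :: "'a::euclidean_space set"
  assumes P: "polytope P" "P \<noteq> {}"
  shows "\<exists>vs. shadow_path P w c vs"
proof -
  let ?E = "{u. u extreme_point_of P}"
  have E: "finite ?E" "?E \<noteq> {}"
    using finite_polytope_extreme_points[OF P(1)] P extreme_point_exists_convex[of P]
      polytope_imp_compact polytope_imp_convex by auto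
  obtain v where v: "v extreme_point_of P" "\<And>u. u extreme_point_of P \<Longrightarrow> w \<bullet> u \<le> w \<bullet> v"
    using arg_min_if_finite(1)[OF E, of "\<lambda>u. - (w \<bullet> u)"]
      arg_min_least[OF E, of _ "\<lambda>u. - (w \<bullet> u)"] by auto
  then have vw: "v \<in> maximizers P (w + 0 *\<^sub>R c)"
    using polytope_inner_le[OF P(1), of w "w \<bullet> v"] by (auto simp: maximizers_def extreme_point_of_def)
  obtain vs \<tau> where vs: "vs \<noteq> []" "hd vs = v" "\<forall>u\<in>set vs. u extreme_point_of P"
      "sorted_wrt (\<lambda>x y. c \<bullet> x < c \<bullet> y) vs" "\<tau> (0::nat) = 0"
      and st: "\<forall>i. Suc i < length vs \<longrightarrow> \<tau> i \<le> \<tau> (Suc i) \<and>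
              closed_segment (vs ! i) (vs ! Suc i) edge_of P \<and>
              closed_segment (vs ! i) (vs ! Suc i) \<subseteq> maximizers P (w + \<tau> (Suc i) *\<^sub>R c)"
      and la: "\<forall>\<nu>\<ge>\<tau> (length vs - 1). last vs \<in> maximizers P (w + \<nu> *\<^sub>R c)"
    using shadow_path_from[OF P(1) v(1) vw] by blast
  have lt: "c \<bullet> (vs ! i) < c \<bullet> (vs ! j)" if "i < j" "j < length vs" for i j
    using vs(4) that by (simp add: sorted_wrt_iff_nth_less)
  have "distinct vs"
    unfolding distinct_conv_nth using lt by (metis less_irrefl linorder_neqE_nat)
  moreover have "\<forall>i. Suc i < length vs \<longrightarrow> c \<bullet> (vs ! i) \<le> c \<bullet> (vs ! Suc i)"
    using lt by (simp add: less_imp_le)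
  ultimately show ?thesis
    unfolding shadow_path_def using vs st la vw
    by (intro exI[of _ vs] conjI exI[of _ \<tau>]) auto
qed


section \<open>Generic shadow paths\<close>

text \<open>
  If the optimal faces are at most edges and the start vertex is the unique optimum for \<open>w\<close>, a
  shadow path lists exactly the shadow vertices, in the order of increasing parameter.
\<close>

theorem shadow_path_generic:
  fixes P :: "'a::euclidean_space set"
  assumes path: "shadow_path P w c vs" and P: "convex P"
    and start: "maximizers P w = {v0}"
    and edges: "\<And>\<mu>. \<mu> \<ge> 0 \<Longrightarrow> aff_dim (maximizers P (w + \<mu> *\<^sub>R c)) \<le> 1"
  shows "set vs = shadow_vertices P w c"
    and "\<exists>\<mu>. \<forall>i<length vs. 0 \<le> \<mu> i \<and> maximizers P (w + \<mu> i *\<^sub>R c) = {vs ! i} \<and>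
           (\<forall>j<i. \<mu> j < \<mu> i)"
proof -
  let ?k = "length vs - 1"
  let ?M = "\<lambda>\<mu>. maximizers P (w + \<mu> *\<^sub>R c)"
  obtain \<tau> where ne: "vs \<noteq> []" and dist: "distinct vs" and ext: "\<forall>v\<in>set vs. v extreme_point_of P"
    and t0: "\<tau> (0::nat) = (0::real)" and hd: "hd vs \<in> maximizers P w"
    and st: "\<And>i. Suc i < length vs \<Longrightarrow> \<tau> i \<le> \<tau> (Suc i) \<and>
           closed_segment (vs ! i) (vs ! Suc i) edge_of P \<and>
           closed_segment (vs ! i) (vs ! Suc i) \<subseteq> ?M (\<tau> (Suc i))"
    and la: "\<And>\<mu>. \<mu> \<ge> \<tau> ?k \<Longrightarrow> last vs \<in> ?M \<mu>"
    using path unfolding shadow_path_def by (elim conjE exE) blast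
  have v0: "vs ! 0 = v0" using hd ne start by (simp add: hd_conv_nth)
  have M0: "?M 0 = {v0}" using start by simp
  have idx01: "vs ! Suc 0 \<noteq> vs ! 0" if "Suc 0 < length vs"
    using nth_eq_iff_index_eq[OF dist, of "Suc 0" 0] that ne by simp
  have pos: "\<tau> i \<ge> 0" if "i < length vs" for i
    using that
  proof (induction i)
    case (Suc i)
    then show ?case using st[of i] by auto
  qed (simp add: t0)
  have at: "vs ! i \<in> ?M (\<tau> (Suc i))" "vs ! Suc i \<in> ?M (\<tau> (Suc i))" if "Suc i < length vs" for i
    using st[OF that] ends_in_segment by blast+
  have seg: "?M (\<tau> (Suc i)) = closed_segment (vs ! i) (vs ! Suc i)" (is "?L = ?R")
    if i: "Suc i < length vs" for i
  proof (rule ccontr)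
    assume n: "?L \<noteq> ?R"
    have F: "?L face_of P" by (rule maximizers_face_of[OF P])
    have R: "?R face_of P" "aff_dim ?R = 1" "?R \<subseteq> ?L"
      using st[OF i] by (auto simp: edge_of_def)
    have "?R face_of ?L"
      using face_of_subset[OF R(1) R(3)] face_of_imp_subset[OF F] by blast
    then have "aff_dim ?R < aff_dim ?L"
      using face_of_aff_dim_lt face_of_imp_convex[OF F] n by metis
    then show False using R edges[OF pos[OF i]] by simp
  qed
  have vertex_in_seg: "vs ! j = vs ! i \<or> vs ! j = vs ! Suc i"
    if "vs ! j \<in> closed_segment (vs ! i) (vs ! Suc i)" "Suc i < length vs" "j < length vs" for i j
  proof -
    have "closed_segment (vs ! i) (vs ! Suc i) face_of P"
      using st[OF that(2)] by (simp add: edge_of_def)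
    from extreme_point_of_face[OF this, of "vs ! j"] show ?thesis
      using that ext by (simp add: extreme_point_of_segment)
  qed
  have vertex_at: "j = i \<or> j = Suc i"
    if "vs ! j \<in> ?M (\<tau> (Suc i))" "Suc i < length vs" "j < length vs" for i j
    using vertex_in_seg[of j i] that seg[of i] dist by (auto simp: nth_eq_iff_index_eq)
  have strict: "\<tau> i < \<tau> (Suc i)" if i: "Suc i < length vs" for i
  proof (rule ccontr)
    assume "\<not> ?thesis"
    then have e: "\<tau> i = \<tau> (Suc i)" using st[OF i] by auto
    show False
    proof (cases i)
      case 0
      then have "vs ! Suc 0 = vs ! 0" using at(2)[OF i] e t0 M0 v0 by auto
      then show False using i idx01 0 by auto
    next
      case (Suc j)
      then show False using vertex_at[of "Suc i" j] at(2)[OF i] e i by auto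
    qed
  qed
  define \<tau>' where "\<tau>' i = (if i = ?k then \<tau> ?k + 1 else \<tau> (Suc i))" for i
  define \<mu> where "\<mu> i = (\<tau> i + \<tau>' i) / 2" for i
  have lt: "\<tau> i < \<mu> i" "\<mu> i < \<tau>' i" if "i < length vs" for i
    using strict[of i] that by (auto simp: \<mu>_def \<tau>'_def)
  have vi: "vs ! i \<in> ?M (\<tau> i)" "vs ! i \<in> ?M (\<tau>' i)" if i: "i < length vs" for i
  proof -
    show "vs ! i \<in> ?M (\<tau> i)" using at(2)[of "i - 1"] i M0 v0 t0 by (cases i) auto
    show "vs ! i \<in> ?M (\<tau>' i)"
    proof (cases "i = ?k")
      case True
      then show ?thesis using la[of "\<tau> ?k + 1"] ne by (simp add: \<tau>'_def last_conv_nth)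
    next
      case False
      then show ?thesis using at(1)[of i] i by (simp add: \<tau>'_def)
    qed
  qed
  have uniq: "?M (\<mu> i) = {vs ! i}" if i: "i < length vs" for i
  proof -
    have mem: "vs ! i \<in> ?M (\<mu> i)"
      using maximizers_between[OF vi[OF i]] lt[OF i] by simp
    have le: "(w + \<nu> *\<^sub>R c) \<bullet> y \<le> (w + \<nu> *\<^sub>R c) \<bullet> (vs ! i)"
      if "vs ! i \<in> ?M \<nu>" "y \<in> P" for \<nu> y
      using that by (auto simp: maximizers_def)
    have tie: "(w + \<nu> *\<^sub>R c) \<bullet> y = (w + \<nu> *\<^sub>R c) \<bullet> (vs ! i)" if y: "y \<in> ?M (\<mu> i)" for y \<nu>
    proof -
      define \<alpha> where "\<alpha> = w \<bullet> (vs ! i) - w \<bullet> y"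
      define \<beta> where "\<beta> = c \<bullet> (vs ! i) - c \<bullet> y"
      have yP: "y \<in> P" using y by (simp add: maximizers_def)
      have a: "\<alpha> + \<tau> i * \<beta> \<ge> 0" "\<alpha> + \<tau>' i * \<beta> \<ge> 0"
        using le[OF vi(1)[OF i] yP] le[OF vi(2)[OF i] yP]
        by (auto simp: \<alpha>_def \<beta>_def inner_simps algebra_simps)
      have "(w + \<mu> i *\<^sub>R c) \<bullet> (vs ! i) \<le> (w + \<mu> i *\<^sub>R c) \<bullet> y"
        using y mem by (simp add: maximizers_def)
      then have b: "\<alpha> + \<mu> i * \<beta> \<le> 0"
        by (simp add: \<alpha>_def \<beta>_def inner_simps algebra_simps)
      have "\<mu> i * \<beta> \<le> \<tau> i * \<beta>" "\<mu> i * \<beta> \<le> \<tau>' i * \<beta>" using a b by linarith+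
      then have "\<beta> = 0" using lt[OF i] by (simp add: mult_le_cancel_right)
      moreover from this a b have "\<alpha> = 0" by simp
      ultimately show ?thesis by (simp add: \<alpha>_def \<beta>_def inner_simps)
    qed
    have max: "y \<in> ?M \<nu>" if "y \<in> ?M (\<mu> i)" "vs ! i \<in> ?M \<nu>" for y \<nu>
      using tie[OF that(1), of \<nu>] that by (auto simp: maximizers_def)
    have "y = vs ! i" if y: "y \<in> ?M (\<mu> i)" for y
    proof (rule ccontr)
      assume yn: "y \<noteq> vs ! i"
      show False
      proof (cases i)
        case 0
        then show False using max[OF y vi(1)[OF i]] t0 M0 v0 yn by simp
      next
        case (Suc j)
        have j: "Suc j < length vs" "vs ! i = vs ! Suc j" using Suc i by auto
        have "y \<in> closed_segment (vs ! j) (vs ! i)"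
          using max[OF y vi(1)[OF i]] seg[OF j(1)] Suc by metis
        then obtain s where s: "y = (1 - s) *\<^sub>R (vs ! j) + s *\<^sub>R (vs ! i)" "0 \<le> s" "s \<le> 1"
          by (auto simp: in_segment)
        then have s1: "1 - s \<noteq> 0" using yn by auto
        have tj: "(w + \<nu> *\<^sub>R c) \<bullet> (vs ! j) = (w + \<nu> *\<^sub>R c) \<bullet> (vs ! i)" for \<nu>
        proof -
          have "(1 - s) * ((w + \<nu> *\<^sub>R c) \<bullet> (vs ! j)) = (1 - s) * ((w + \<nu> *\<^sub>R c) \<bullet> (vs ! i))"
            using tie[OF y, of \<nu>] unfolding s(1) inner_add_right inner_scaleR_right
            by (simp add: left_diff_distrib)
          then show ?thesis using s1 by simp
        qed
        have "vs ! j \<in> ?M (\<tau> j)" using vi(1)[of j] j by simp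
        then have "vs ! i \<in> ?M (\<tau> j)"
          using tj[of "\<tau> j"] mem by (auto simp: maximizers_def)
        then show False
          using vertex_at[of i "j - 1"] i Suc t0 M0 v0 idx01
          by (cases j) auto
      qed
    qed
    then show ?thesis using mem by blast
  qed
  have mono: "\<tau> i \<le> \<tau> j" if "i \<le> j" "j < length vs" for i j
    using that
  proof (induction j rule: dec_induct)
    case (step n)
    then show ?case using st[of n] by auto
  qed simp
  have order: "\<mu> j < \<mu> i" if "j < i" "i < length vs" for i j
  proof -
    have "\<mu> j < \<tau>' j" using lt(2)[of j] that by simp
    also have "\<tau>' j \<le> \<tau> i" using mono[of "Suc j" i] that by (auto simp: \<tau>'_def)
    also have "\<tau> i < \<mu> i" using lt(1) that by simp
    finally show ?thesis .
  qed
  have nonneg: "0 \<le> \<mu> i" if "i < length vs" for i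
    using pos[OF that] lt(1)[OF that] by simp
  show "\<exists>\<mu>. \<forall>i<length vs. 0 \<le> \<mu> i \<and> ?M (\<mu> i) = {vs ! i} \<and> (\<forall>j<i. \<mu> j < \<mu> i)"
    using nonneg uniq order by (intro exI[of _ \<mu>]) auto
  have "set vs \<subseteq> shadow_vertices P w c"
    using nonneg uniq by (fastforce simp: shadow_vertices_def in_set_conv_nth)
  then show "set vs = shadow_vertices P w c"
    using shadow_path_contains_shadow_vertices[OF path] by blast
qed

end

(*
  Here w = (1, ..., 1), so c is orthogonal to w iff its entries sum to 0, and some entry of c, say
  the i-th, is maximal and positive. P is an intersection of d + 1 pieces, one per coordinate; the
  piece of i ("plate i") has 2^(d-1) points each of which is, for every such c, the unique maximizer
  of w + \<mu> c for some \<mu> > 0.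

  A plate is an affine image of a "gadget", a system of 2 d inequalities
  z + n_0 y_0 + ... + n_j y_j <= b, where j = d - 1, with 2^j points, each exposed by all objectives
  z + c_0 y_0 + ... + c_j y_j with c_0, ..., c_{j-1} close to 1 and c_j close to a suitable s. It is
  built by induction on j: adding z + y_0 + ... + y_{j-1} + 3 y_j +- 2 y_{j+1} <= B splits each point
  in two. The affine map depends on a radius r and a large constant L, and under it w + \<mu> c becomes
  the gadget objective with coefficients 1 + \<mu> c_k / (L r) and \<mu> c_i / r - 3. Varying \<mu> thus moves
  the last coefficient over all of the interval (-1, 1), while the others stay close to 1.

  If the radii are far apart and the gadgets are shrunk enough, the points of each plate satisfy the
  constraints of the other plates strictly. The lower bound w x >= -K makes P bounded, and cutting
  off further vertices, one at a time, adjusts the number of facets.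
*)
theory Submission
  imports Defs
begin

section \<open>Small inequality systems with exponentially many stably exposed points\<close>

section \<open>Gadgets\<close>

text \<open>A point is a height \<open>z\<close>, always with coefficient 1, and a sequence
  \<open>y\<close> of which only the entries up to \<open>j\<close> occur. Sequences keep the type
  fixed while \<open>j\<close> grows in the induction.\<close>

definition satisfies :: "nat \<Rightarrow> ((nat \<Rightarrow> real) \<times> real) set \<Rightarrow> real \<Rightarrow> (nat \<Rightarrow> real) \<Rightarrow> bool" where
  "satisfies j T z y \<longleftrightarrow> (\<forall>(n, b)\<in>T. z + (\<Sum>k\<le>j. n k * y k) \<le> b)"

text \<open>The point is the unique optimum for a whole box of objectives. The slack
  \<open>\<delta>\<close> absorbs the perturbations of the induction step and, later, coefficients
  \<open>1 + d $ g k / (L * r)\<close> that are only close to 1.\<close>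

definition exposed_near ::
    "nat \<Rightarrow> ((nat \<Rightarrow> real) \<times> real) set \<Rightarrow> real \<Rightarrow> real \<Rightarrow> real \<Rightarrow> (nat \<Rightarrow> real) \<Rightarrow> bool" where
  "exposed_near j T s \<delta> z y \<longleftrightarrow>
     (\<forall>c. (\<forall>k<j. \<bar>c k - 1\<bar> \<le> \<delta>) \<longrightarrow> \<bar>c j - s\<bar> \<le> \<delta> \<longrightarrow>
       (\<forall>z' y'. satisfies j T z' y' \<longrightarrow>
          z' + (\<Sum>k\<le>j. c k * y' k) \<le> z + (\<Sum>k\<le>j. c k * y k) \<and>
          (z' + (\<Sum>k\<le>j. c k * y' k) = z + (\<Sum>k\<le>j. c k * y k) \<longrightarrow>
             z' = z \<and> (\<forall>k\<le>j. y' k = y k))))"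

text \<open>The value 3 lies above 1 and the coefficient \<open>s\<close> below it, so mixing them
  can produce 1, the value required of coordinate \<open>j\<close> once \<open>Suc j\<close> is the
  last one.\<close>

definition lift_coeff :: "nat \<Rightarrow> nat \<Rightarrow> real" where
  "lift_coeff j k = (if k < j then 1 else 3)"

definition lifted_constraints ::
    "nat \<Rightarrow> real \<Rightarrow> ((nat \<Rightarrow> real) \<times> real) set \<Rightarrow> ((nat \<Rightarrow> real) \<times> real) set" where
  "lifted_constraints j B T =
     (\<lambda>(n, b). (n(Suc j := 0), b)) ` T \<union>
     (\<lambda>\<sigma>. ((lift_coeff j)(Suc j := 2 * \<sigma>), B)) ` {1, -1}"

lemma satisfies_lifted:
  "satisfies (Suc j) (lifted_constraints j B T) z y \<longleftrightarrow>
     satisfies j T z y \<and> z + (\<Sum>k\<le>j. lift_coeff j k * y k) + 2 * \<bar>y (Suc j)\<bar> \<le> B"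
proof -
  have "(\<Sum>k\<le>j. (n(Suc j := a)) k * y k) = (\<Sum>k\<le>j. n k * y k)" for n :: "nat \<Rightarrow> real" and a
    by (intro sum.cong) auto
  then show ?thesis
    unfolding satisfies_def lifted_constraints_def
    by (auto simp: abs_if split: if_splits)
qed

text \<open>
  The objective with coefficients \<open>c\<close> is a convex combination of a new constraint, with weight
  \<open>t = \<sigma> * c (Suc j) / 2\<close>, and of an objective on the old coordinates whose last coefficient is
  close to \<open>s\<close> precisely because \<open>t\<close> is close to \<open>(1 - s) / (3 - s)\<close>.
\<close>

lemma exposed_near_lift:
  assumes exp: "exposed_near j T s \<delta> z y" and s: "\<bar>s\<bar> < 1" and \<delta>: "\<delta> > 0"
    and \<sigma>: "\<sigma> \<in> {1, -1::real}"
    and h: "h = (B - (z + (\<Sum>k\<le>j. lift_coeff j k * y k))) / 2" "h > 0"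
  shows "\<exists>s' \<delta>'. \<bar>s'\<bar> < 1 \<and> \<delta>' > 0 \<and>
           exposed_near (Suc j) (lifted_constraints j B T) s' \<delta>' z (y(Suc j := \<sigma> * h))"
proof -
  \<comment> \<open>\<open>t0\<close> solves \<open>(1 - t0) * s + t0 * 3 = 1\<close>. It is below
    1/2 because \<open>s > -1\<close>, which keeps the new last coefficient \<open>2 * t0\<close>
    below 1.\<close>
  define t0 where "t0 = (1 - s) / (3 - s)"
  have t0: "t0 > 0" "t0 < 1/2" "t0 * (3 - s) = 1 - s"
    using s by (auto simp: t0_def field_simps)
  \<comment> \<open>Errors of at most \<open>3 * \<delta>'\<close> get divided by
    \<open>1 - t\<close>, which is at least 1/4; hence the 12. The other two bounds keep
    \<open>t\<close> positive and at most 3/4.\<close>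
  define \<delta>' where "\<delta>' = min (\<delta> / 12) (min t0 (1/2))"
  have \<delta>': "\<delta>' > 0" "\<delta>' \<le> \<delta> / 12" "\<delta>' \<le> t0" "\<delta>' \<le> 1/2"
    using \<delta> t0 by (auto simp: \<delta>'_def)
  have "exposed_near (Suc j) (lifted_constraints j B T) (\<sigma> * (2 * t0)) \<delta>' z (y(Suc j := \<sigma> * h))"
    unfolding exposed_near_def
  proof (intro allI impI)
    fix c :: "nat \<Rightarrow> real" and z' y'
    assume c: "\<forall>k<Suc j. \<bar>c k - 1\<bar> \<le> \<delta>'" "\<bar>c (Suc j) - \<sigma> * (2 * t0)\<bar> \<le> \<delta>'"
      and f: "satisfies (Suc j) (lifted_constraints j B T) z' y'"
    define t where "t = \<sigma> * c (Suc j) / 2"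
    have ct: "c (Suc j) = \<sigma> * (2 * t)" using \<sigma> by (auto simp: t_def)
    have tt: "\<bar>t - t0\<bar> \<le> \<delta>' / 2"
    proof -
      have "\<bar>\<sigma> * (c (Suc j) - \<sigma> * (2 * t0))\<bar> \<le> \<delta>'" using c(2) \<sigma> by (auto simp: abs_mult)
      moreover have "\<sigma> * (c (Suc j) - \<sigma> * (2 * t0)) = 2 * (t - t0)"
        using \<sigma> by (auto simp: t_def algebra_simps)
      ultimately have "\<bar>2 * (t - t0)\<bar> \<le> \<delta>'" by (simp only:)
      then have "2 * (t - t0) \<le> \<delta>'" "2 * (t0 - t) \<le> \<delta>'" by auto
      then show ?thesis by (intro abs_leI) simp_all
    qed
    then have t: "0 < t" "t \<le> 3/4" using t0 \<delta>' by linarith+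
    \<comment> \<open>What remains of the objective after removing \<open>t\<close> times the new
      constraint, rescaled to give \<open>z\<close> the coefficient 1 again.\<close>
    define c' where "c' k = (c k - t * lift_coeff j k) / (1 - t)" for k
    have div: "\<bar>a / (1 - t)\<bar> \<le> \<delta>" if "\<bar>a\<bar> \<le> 3 * \<delta>'" for a
    proof -
      have "\<bar>a\<bar> \<le> \<delta> * (1/4)" using that \<delta>' by linarith
      also have "\<dots> \<le> \<delta> * (1 - t)" using t \<delta> by (intro mult_left_mono) auto
      finally show ?thesis using t by (simp add: abs_divide divide_le_eq)
    qed
    have c'k: "\<bar>c' k - 1\<bar> \<le> \<delta>" if "k < j" for k
    proof -
      have "c' k - 1 = (c k - 1) / (1 - t)" using t that
        by (simp add: c'_def lift_coeff_def field_simps)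
      then show ?thesis using div[of "c k - 1"] c(1)[rule_format, of k] that \<delta>' by simp
    qed
    have c'j: "\<bar>c' j - s\<bar> \<le> \<delta>"
    proof -
      have "c' j - s = ((c j - 1) + (1 - s) - (3 - s) * t) / (1 - t)" using t
        by (simp add: c'_def lift_coeff_def field_simps)
      also have "\<dots> = ((c j - 1) + (3 - s) * (t0 - t)) / (1 - t)"
        unfolding t0(3)[symmetric] by (simp add: algebra_simps)
      finally have e: "c' j - s = ((c j - 1) + (3 - s) * (t0 - t)) / (1 - t)" .
      have "\<bar>(3 - s) * (t0 - t)\<bar> \<le> 4 * (\<delta>' / 2)"
        unfolding abs_mult using s tt by (intro mult_mono) (auto simp: abs_minus_commute)
      moreover have "\<bar>c j - 1\<bar> \<le> \<delta>'" using c(1) by simp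
      ultimately have "\<bar>(c j - 1) + (3 - s) * (t0 - t)\<bar> \<le> 3 * \<delta>'" by linarith
      then show ?thesis unfolding e by (rule div)
    qed
    have split: "(\<Sum>k\<le>j. c k * u k) =
        (1 - t) * (\<Sum>k\<le>j. c' k * u k) + t * (\<Sum>k\<le>j. lift_coeff j k * u k)" for u
      unfolding sum_distrib_left sum.distrib[symmetric] using t
      by (intro sum.cong) (auto simp: c'_def field_simps)
    have f': "satisfies j T z' y'"
      and fb: "z' + (\<Sum>k\<le>j. lift_coeff j k * y' k) + 2 * \<bar>y' (Suc j)\<bar> \<le> B"
      using f unfolding satisfies_lifted by auto
    let ?A = "z + (\<Sum>k\<le>j. c' k * y k)" and ?A' = "z' + (\<Sum>k\<le>j. c' k * y' k)"
    let ?B' = "z' + (\<Sum>k\<le>j. lift_coeff j k * y' k) + 2 * (\<sigma> * y' (Suc j))"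
    have le: "?A' \<le> ?A" and eq: "?A' = ?A \<longrightarrow> z' = z \<and> (\<forall>k\<le>j. y' k = y k)"
      using exp f' c'k c'j unfolding exposed_near_def by blast+
    have leB: "?B' \<le> B" using fb \<sigma> by auto
    have hB: "z + (\<Sum>k\<le>j. lift_coeff j k * y k) + 2 * h = B" using h by simp
    have L: "z' + (\<Sum>k\<le>Suc j. c k * y' k) = (1 - t) * ?A' + t * ?B'"
      by (simp add: split ct algebra_simps)
    have R: "z + (\<Sum>k\<le>Suc j. c k * (y(Suc j := \<sigma> * h)) k) = (1 - t) * ?A + t * B"
    proof -
      have "(\<Sum>k\<le>j. c k * (y(Suc j := \<sigma> * h)) k) = (\<Sum>k\<le>j. c k * y k)"
        by (intro sum.cong) auto
      moreover have "\<sigma> * \<sigma> = 1" using \<sigma> by auto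
      then have "c (Suc j) * (\<sigma> * h) = t * (2 * h)" unfolding ct by (simp add: ac_simps)
      ultimately show ?thesis unfolding hB[symmetric] by (simp add: split algebra_simps)
    qed
    \<comment> \<open>Both weights are positive, so equality of the weighted sums forces equality in
      each inequality: the first fixes the old coordinates, the second then fixes
      \<open>y' (Suc j)\<close>.\<close>
    have m: "(1 - t) * ?A' \<le> (1 - t) * ?A" "t * ?B' \<le> t * B"
      using t le leB by (auto intro: mult_left_mono)
    show "z' + (\<Sum>k\<le>Suc j. c k * y' k) \<le> z + (\<Sum>k\<le>Suc j. c k * (y(Suc j := \<sigma> * h)) k) \<and>
          (z' + (\<Sum>k\<le>Suc j. c k * y' k) = z + (\<Sum>k\<le>Suc j. c k * (y(Suc j := \<sigma> * h)) k) \<longrightarrow>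
             z' = z \<and> (\<forall>k\<le>Suc j. y' k = (y(Suc j := \<sigma> * h)) k))"
    proof (intro conjI impI)
      show "z' + (\<Sum>k\<le>Suc j. c k * y' k) \<le> z + (\<Sum>k\<le>Suc j. c k * (y(Suc j := \<sigma> * h)) k)"
        unfolding L R using m by linarith
      assume E: "z' + (\<Sum>k\<le>Suc j. c k * y' k) = z + (\<Sum>k\<le>Suc j. c k * (y(Suc j := \<sigma> * h)) k)"
      have "(1 - t) * ?A' = (1 - t) * ?A" "t * ?B' = t * B"
        using E m unfolding L R by linarith+
      then have AB: "?A' = ?A" "?B' = B" using t unfolding mult_cancel_left by linarith+
      have zy: "z' = z" "\<forall>k\<le>j. y' k = y k" using eq AB(1) by blast+
      from zy(2) have "(\<Sum>k\<le>j. lift_coeff j k * y' k) = (\<Sum>k\<le>j. lift_coeff j k * y k)"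
        by (intro sum.cong) auto
      then have "\<sigma> * y' (Suc j) = h" using AB(2) hB zy(1) by linarith
      then have "y' (Suc j) = \<sigma> * h" using \<sigma> by auto
      then show "z' = z" "\<forall>k\<le>Suc j. y' k = (y(Suc j := \<sigma> * h)) k"
        using zy by (auto simp: le_Suc_eq)
    qed
  qed
  moreover have "\<bar>\<sigma> * (2 * t0)\<bar> < 1" using t0 \<sigma> by auto
  ultimately show ?thesis using \<delta>'(1) by blast
qed

text \<open>Two side conditions serve the plates: \<open>- 2 \<le> n j\<close> gives
  \<open>n j + 3 \<ge> 1\<close> and \<open>n j + 5/2 > 0\<close> there, and the vanishing of
  \<open>y\<close> beyond \<open>j\<close> lets the coordinates up to \<open>j\<close> tell the
  members of \<open>V\<close> apart.\<close>

lemma gadget_exists: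
  "\<exists>(T :: ((nat \<Rightarrow> real) \<times> real) set) (V :: (real \<times> (nat \<Rightarrow> real)) set).
     finite T \<and> card T \<le> 2 * Suc j \<and> (\<forall>(n, b)\<in>T. - 2 \<le> n j) \<and> finite V \<and> card V = 2 ^ j \<and>
     (\<forall>(z, y)\<in>V. satisfies j T z y \<and> (\<forall>k>j. y k = 0) \<and>
        (\<exists>s \<delta>. \<bar>s\<bar> < 1 \<and> \<delta> > 0 \<and> exposed_near j T s \<delta> z y))"
proof (induction j)
  case 0
  \<comment> \<open>The wedge \<open>z + \<bar>y 0\<bar> \<le> 0\<close> with its apex at the
    origin; only index 0 of the coefficient functions matters.\<close>
  define T :: "((nat \<Rightarrow> real) \<times> real) set" where "T = {(\<lambda>_. 1, 0), (\<lambda>_. -1, 0)}"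
  have "exposed_near 0 T 0 (1/2) 0 (\<lambda>_. 0)"
    unfolding exposed_near_def
  proof (intro allI impI)
    fix c :: "nat \<Rightarrow> real" and z' y'
    assume c: "\<bar>c 0 - 0\<bar> \<le> 1/2" and f: "satisfies 0 T z' y'"
    have z: "z' + \<bar>y' 0\<bar> \<le> 0" using f by (auto simp: satisfies_def T_def)
    have "\<bar>c 0 * y' 0\<bar> \<le> 1/2 * \<bar>y' 0\<bar>"
      unfolding abs_mult using c by (intro mult_right_mono) auto
    then show "z' + (\<Sum>k\<le>0. c k * y' k) \<le> 0 + (\<Sum>k\<le>0. c k * 0) \<and>
          (z' + (\<Sum>k\<le>0. c k * y' k) = 0 + (\<Sum>k\<le>0. c k * 0) \<longrightarrow>
             z' = 0 \<and> (\<forall>k\<le>0. y' k = 0))"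
      using z by auto
  qed
  moreover have "card T \<le> 2 * Suc 0" unfolding T_def using card_insert_le_m1[of 2 "{(\<lambda>_. -1, 0)}"] by simp
  moreover have "\<bar>0 :: real\<bar> < 1" "(1/2 :: real) > 0" by auto
  ultimately have "\<exists>s \<delta>. \<bar>s\<bar> < 1 \<and> \<delta> > 0 \<and> exposed_near 0 T s \<delta> 0 (\<lambda>_. 0)" by blast
  with \<open>card T \<le> 2 * Suc 0\<close> show ?case
    by (intro exI[of _ T] exI[of _ "{(0, \<lambda>_. 0)}"]) (simp add: T_def satisfies_def)
next
  case (Suc j)
  from Suc.IH obtain T :: "((nat \<Rightarrow> real) \<times> real) set" and V :: "(real \<times> (nat \<Rightarrow> real)) set"
    where TV: "finite T \<and> card T \<le> 2 * Suc j \<and> (\<forall>(n, b)\<in>T. - 2 \<le> n j) \<and> finite V \<and> card V = 2 ^ j \<and>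
     (\<forall>(z, y)\<in>V. satisfies j T z y \<and> (\<forall>k>j. y k = 0) \<and>
        (\<exists>s \<delta>. \<bar>s\<bar> < 1 \<and> \<delta> > 0 \<and> exposed_near j T s \<delta> z y))"
    by (elim exE)
  then have T: "finite T" "card T \<le> 2 * Suc j" and V: "finite V" "card V = 2 ^ j"
    by (simp_all only:)
  have v: "satisfies j T z y \<and> (\<forall>k>j. y k = 0) \<and>
        (\<exists>s \<delta>. \<bar>s\<bar> < 1 \<and> \<delta> > 0 \<and> exposed_near j T s \<delta> z y)" if "(z, y) \<in> V" for z y
    using bspec[OF TV[THEN conjunct2, THEN conjunct2, THEN conjunct2, THEN conjunct2, THEN conjunct2] that]
    unfolding case_prod_conv .
  define \<phi> where "\<phi> = (\<lambda>(z, y). z + (\<Sum>k\<le>j. lift_coeff j k * y k))"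
  \<comment> \<open>Exceeding all values of \<open>\<phi>\<close> makes the splitting height
    positive at every point; the inserted 0 gives \<open>Max\<close> a nonempty set.\<close>
  define B where "B = Max (insert 0 (\<phi> ` V)) + 1"
  have B: "\<phi> p < B" if "p \<in> V" for p
  proof -
    have "\<phi> p \<le> Max (insert 0 (\<phi> ` V))" using V that by (intro Max_ge) auto
    then show ?thesis by (simp add: B_def)
  qed
  \<comment> \<open>Each point is doubled by the sign of its new coordinate, whose size makes the
    new constraint of the same sign tight.\<close>
  define L where "L = (\<lambda>((z, y), \<sigma>). (z :: real, y(Suc j := \<sigma> * ((B - \<phi> (z, y)) / 2))))"
  have inj: "inj_on L (V \<times> {1, -1})"
  proof (rule inj_onI)
    fix p q assume p: "p \<in> V \<times> {1, -1}" and q: "q \<in> V \<times> {1, -1}" and e: "L p = L q"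
    obtain z y \<sigma> z' y' \<sigma>' where pq: "p = ((z, y), \<sigma>)" "q = ((z', y'), \<sigma>')"
      by (metis surj_pair)
    have zz: "z = z'" and f: "y(Suc j := \<sigma> * ((B - \<phi> (z, y)) / 2)) = y'(Suc j := \<sigma>' * ((B - \<phi> (z', y')) / 2))"
      using e unfolding L_def pq by auto
    have "y k = y' k" for k
      using fun_cong[OF f, of k] v[of z y] v[of z' y'] p q unfolding pq by (cases "k = Suc j") auto
    then have yy: "y = y'" by auto
    have "\<sigma> * ((B - \<phi> (z, y)) / 2) = \<sigma>' * ((B - \<phi> (z, y)) / 2)"
      using fun_cong[OF f, of "Suc j"] zz yy by simp
    moreover have "B - \<phi> (z, y) > 0" using B[of "(z, y)"] p pq by auto
    ultimately have "\<sigma> = \<sigma>'" by simp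
    then show "p = q" using zz yy pq by simp
  qed
  let ?T = "lifted_constraints j B T" and ?V = "L ` (V \<times> {1, -1})"
  have "card ?T \<le> 2 * Suc (Suc j)"
  proof -
    have "card ?T \<le> card ((\<lambda>(n, b). (n(Suc j := 0), b)) ` T)
        + card ((\<lambda>\<sigma>. ((lift_coeff j)(Suc j := 2 * \<sigma>), B)) ` {1, -1})"
      unfolding lifted_constraints_def by (rule card_Un_le)
    also have "\<dots> \<le> card T + card {1, -1 :: real}"
      using T by (intro add_mono card_image_le) auto
    also have "\<dots> \<le> 2 * Suc (Suc j)" using T by simp
    finally show ?thesis .
  qed
  moreover have "finite ?T" using T by (auto simp: lifted_constraints_def)
  moreover have "\<forall>(n, b)\<in>?T. - 2 \<le> n (Suc j)" by (auto simp: lifted_constraints_def)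
  moreover have "card ?V = 2 ^ Suc j"
    using V by (simp add: card_image[OF inj] card_cartesian_product)
  moreover have "satisfies (Suc j) ?T (fst p) (snd p) \<and> (\<forall>k>Suc j. snd p k = 0) \<and>
        (\<exists>s \<delta>. \<bar>s\<bar> < 1 \<and> \<delta> > 0 \<and> exposed_near (Suc j) ?T s \<delta> (fst p) (snd p))"
    if p_in: "p \<in> ?V" for p
  proof -
    obtain q where q: "q \<in> V \<times> {1, -1}" "p = L q" using p_in by (elim imageE)
    obtain z y \<sigma> where "q = ((z, y), \<sigma>)" by (metis surj_pair)
    then have zy: "(z, y) \<in> V" and \<sigma>: "\<sigma> \<in> {1, -1}" and p: "p = L ((z, y), \<sigma>)"
      using q by simp_all
    define h where "h = (B - (z + (\<Sum>k\<le>j. lift_coeff j k * y k))) / 2"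
    have h0: "h > 0" using B[OF zy] by (simp add: h_def \<phi>_def)
    have p: "fst p = z" "snd p = y(Suc j := \<sigma> * h)"
      using p by (auto simp: L_def h_def \<phi>_def)
    obtain s \<delta> where s: "\<bar>s\<bar> < 1" "\<delta> > 0" "exposed_near j T s \<delta> z y" using v[OF zy] by blast
    have e: "(\<Sum>k\<le>j. n k * (y(Suc j := \<sigma> * h)) k) = (\<Sum>k\<le>j. n k * y k)" for n :: "nat \<Rightarrow> real"
      by (intro sum.cong) auto
    have sat: "satisfies j T z (y(Suc j := \<sigma> * h))"
      using v[OF zy] unfolding satisfies_def e by blast
    have "\<bar>\<sigma> * h\<bar> = h" using \<sigma> h0 by auto
    moreover have "2 * h = B - (z + (\<Sum>k\<le>j. lift_coeff j k * y k))" by (simp add: h_def)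
    ultimately have "z + (\<Sum>k\<le>j. lift_coeff j k * y k) + 2 * \<bar>(y(Suc j := \<sigma> * h)) (Suc j)\<bar> \<le> B"
      unfolding fun_upd_same by linarith
    then have "satisfies (Suc j) ?T z (y(Suc j := \<sigma> * h))"
      unfolding satisfies_lifted e using sat by blast
    then show ?thesis
      using exposed_near_lift[OF s(3,1,2) \<sigma> h_def h0] v[OF zy] unfolding p by auto
  qed
  moreover have "finite ?V" using V by simp
  ultimately show ?case
    unfolding case_prod_unfold
    by (intro exI[of _ ?T] exI[of _ ?V] conjI[of "finite ?T"] conjI[of "card ?T \<le> _"] conjI[of "finite ?V"]
        conjI[of "card ?V = _"] conjI[of "Ball ?T _"] ballI[of ?V])
qed

section \<open>Irredundant systems of half-spaces and their facets\<close>

section \<open>Counting and adding facets\<close>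

definition halfspaces :: "('a::real_inner \<times> real) set \<Rightarrow> 'a set" where
  "halfspaces H = {x. \<forall>h\<in>H. fst h \<bullet> x \<le> snd h}"

definition strictly :: "('a::real_inner \<times> real) set \<Rightarrow> 'a \<Rightarrow> bool" where
  "strictly H x \<longleftrightarrow> (\<forall>h\<in>H. fst h \<bullet> x < snd h)"

text \<open>The witness \<open>q\<close> lies in the relative interior of the facet of
  \<open>h\<close>. It survives every new constraint that it satisfies strictly, which is how
  \<open>cut_off_vertex\<close> preserves irredundance.\<close>

definition irredundant :: "('a::real_inner \<times> real) set \<Rightarrow> bool" where
  "irredundant H \<longleftrightarrow> (\<forall>h\<in>H. \<exists>q. fst h \<bullet> q = snd h \<and> strictly (H - {h}) q)"

lemma strictly_imp_halfspaces: "strictly H x \<Longrightarrow> x \<in> halfspaces H"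
  by (auto simp: strictly_def halfspaces_def less_imp_le)

lemma strictly_mono: "strictly H x \<Longrightarrow> G \<subseteq> H \<Longrightarrow> strictly G x"
  by (auto simp: strictly_def)

lemma halfspaces_mono: "G \<subseteq> H \<Longrightarrow> halfspaces H \<subseteq> halfspaces G"
  by (auto simp: halfspaces_def)

lemma strictly_between:
  assumes "strictly H p" "x \<in> halfspaces H" "0 \<le> t" "t < 1"
  shows "strictly H ((1 - t) *\<^sub>R p + t *\<^sub>R x)"
  unfolding strictly_def
proof
  fix h assume h: "h \<in> H"
  have "(1 - t) * (fst h \<bullet> p) < (1 - t) * snd h"
    using assms h by (intro mult_strict_left_mono) (auto simp: strictly_def)
  moreover have "t * (fst h \<bullet> x) \<le> t * snd h"
    using assms h by (intro mult_left_mono) (auto simp: halfspaces_def)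
  moreover have "(1 - t) * snd h + t * snd h = snd h" by (simp add: algebra_simps)
  ultimately show "fst h \<bullet> ((1 - t) *\<^sub>R p + t *\<^sub>R x) < snd h"
    unfolding inner_add_right inner_scaleR_right by linarith
qed

lemma hyperplane_crossing:
  fixes a :: "'a::real_inner"
  assumes "a \<bullet> p < b" "b < a \<bullet> x"
  obtains t where "0 < t" "t < 1" "a \<bullet> ((1 - t) *\<^sub>R p + t *\<^sub>R x) = b"
proof
  let ?t = "(b - a \<bullet> p) / (a \<bullet> x - a \<bullet> p)"
  show "0 < ?t" "?t < 1" using assms by auto
  have "a \<bullet> ((1 - t) *\<^sub>R p + t *\<^sub>R x) = a \<bullet> p + t * (a \<bullet> x - a \<bullet> p)" for t
    by (simp add: inner_simps algebra_simps)
  then have "a \<bullet> ((1 - ?t) *\<^sub>R p + ?t *\<^sub>R x) = a \<bullet> p + ?t * (a \<bullet> x - a \<bullet> p)" .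
  also have "\<dots> = b" using assms by simp
  finally show "a \<bullet> ((1 - ?t) *\<^sub>R p + ?t *\<^sub>R x) = b" .
qed

lemma irredundant_subset_exists:
  assumes "finite H" "strictly H p"
  shows "\<exists>G\<subseteq>H. halfspaces G = halfspaces H \<and> irredundant G"
  using assms
proof (induction H rule: finite_psubset_induct)
  case (psubset H)
  show ?case
  proof (cases "irredundant H")
    case False
    then obtain h where h: "h \<in> H" and n: "\<And>q. fst h \<bullet> q = snd h \<Longrightarrow> \<not> strictly (H - {h}) q"
      unfolding irredundant_def by blast
    have p: "strictly (H - {h}) p" using strictly_mono[OF psubset.prems] by blast
    have "x \<in> halfspaces H" if x: "x \<in> halfspaces (H - {h})" for x
    proof (rule ccontr)
      assume "x \<notin> halfspaces H"
      then have "snd h < fst h \<bullet> x" using x by (force simp: halfspaces_def)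
      moreover have "fst h \<bullet> p < snd h" using psubset.prems h by (simp add: strictly_def)
      ultimately obtain t where "0 < t" "t < 1" "fst h \<bullet> ((1 - t) *\<^sub>R p + t *\<^sub>R x) = snd h"
        using hyperplane_crossing by blast
      then show False using n strictly_between[OF p x, of t] by (auto simp del: inner_simps)
    qed
    then have eq: "halfspaces (H - {h}) = halfspaces H"
      using halfspaces_mono[of "H - {h}" H] by blast
    have "H - {h} \<subset> H" using h by blast
    from psubset.IH[OF this p] eq show ?thesis by (metis Diff_subset order_trans)
  qed auto
qed

lemma halfspaces_eq_Inter: "halfspaces H = \<Inter> ((\<lambda>h. {x. fst h \<bullet> x \<le> snd h}) ` H)"
  by (auto simp: halfspaces_def)

lemma interior_halfspaces:
  fixes H :: "('a::euclidean_space \<times> real) set"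
  assumes "finite H" "strictly H p"
  shows "p \<in> interior (halfspaces H)"
proof -
  have "open {x. strictly H x}"
  proof -
    have "{x. strictly H x} = (\<Inter>h\<in>H. {x. fst h \<bullet> x < snd h})" by (auto simp: strictly_def)
    then show ?thesis using assms(1) by (auto intro!: open_halfspace_lt)
  qed
  then show ?thesis
    using assms(2) by (intro interiorI[of "{x. strictly H x}"]) (auto intro: strictly_imp_halfspaces)
qed

text \<open>Facets of a polyhedron correspond to the members of a minimal family of half-spaces.
  Minimality, and distinctness of the half-spaces, come from points violating a single constraint;
  distinctness of the facets comes from the witnesses.\<close>

lemma facets_irredundant:
  fixes H :: "('a::euclidean_space \<times> real) set"
  assumes fin: "finite H" and p: "strictly H p" and irr: "irredundant H"
  shows "card {F. F facet_of halfspaces H} = card H"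
proof -
  let ?S = "halfspaces H" and ?half = "\<lambda>h :: 'a \<times> real. {x. fst h \<bullet> x \<le> snd h}"
  have "\<exists>q. fst h \<bullet> q = snd h \<and> strictly (H - {h}) q" if "h \<in> H" for h
    using irr that unfolding irredundant_def by blast
  then obtain q where q: "\<And>h. h \<in> H \<Longrightarrow> fst h \<bullet> q h = snd h"
      "\<And>h. h \<in> H \<Longrightarrow> strictly (H - {h}) (q h)"
    by metis
  have qS: "q h \<in> ?S" if "h \<in> H" for h
    using q[OF that] by (force simp: halfspaces_def strictly_def)
  have qlt: "fst k \<bullet> q h < snd k" if "h \<in> H" "k \<in> H" "k \<noteq> h" for h k
    using q(2)[OF that(1)] that by (auto simp: strictly_def)
  have nz: "fst h \<noteq> 0" if "h \<in> H" for h
    using p q(1)[OF that] that by (force simp: strictly_def)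
  \<comment> \<open>The witness is strict for the finitely many other constraints, so a small step
    along the normal of \<open>h\<close> violates \<open>h\<close> alone.\<close>
  have viol: "\<exists>y. snd h < fst h \<bullet> y \<and> strictly (H - {h}) y" if h: "h \<in> H" for h
  proof -
    have "eventually (\<lambda>e. \<forall>k\<in>H - {h}. fst k \<bullet> (q h + e *\<^sub>R fst h) < snd k) (at_right (0::real))"
    proof (intro eventually_ball_finite ballI)
      fix k assume "k \<in> H - {h}"
      then have "fst k \<bullet> q h < snd k" using qlt h by blast
      moreover have "((\<lambda>e. fst k \<bullet> (q h + e *\<^sub>R fst h)) \<longlongrightarrow> fst k \<bullet> (q h + 0 *\<^sub>R fst h)) (at_right (0::real))"
        by (intro tendsto_intros)
      ultimately show "eventually (\<lambda>e. fst k \<bullet> (q h + e *\<^sub>R fst h) < snd k) (at_right (0::real))"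
        by (intro order_tendstoD(2)) auto
    qed (use fin in auto)
    then have "eventually (\<lambda>e. e > 0 \<and> (\<forall>k\<in>H - {h}. fst k \<bullet> (q h + e *\<^sub>R fst h) < snd k)) (at_right (0::real))"
      using eventually_at_right_less[of 0] by (rule eventually_elim2) auto
    then obtain e where e: "e > 0" "\<forall>k\<in>H - {h}. fst k \<bullet> (q h + e *\<^sub>R fst h) < snd k"
      using eventually_happens'[OF trivial_limit_at_right_real] by blast
    moreover have "snd h < fst h \<bullet> (q h + e *\<^sub>R fst h)"
      using q(1)[OF h] e(1) nz[OF h] by (simp add: inner_add_right)
    ultimately show ?thesis unfolding strictly_def by blast
  qed
  define F where "F = ?half ` H"
  have inj: "inj_on ?half H"
  proof (rule inj_onI, rule ccontr)
    fix h k assume hk: "h \<in> H" "k \<in> H" "?half h = ?half k" "h \<noteq> k"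
    obtain y where "snd h < fst h \<bullet> y" "strictly (H - {h}) y" using viol[OF hk(1)] by blast
    moreover have "k \<in> H - {h}" using hk(2,4) by blast
    ultimately have "y \<in> ?half k" "y \<notin> ?half h" by (simp_all add: strictly_def less_imp_le)
    then show False using hk(3) by blast
  qed
  \<comment> \<open>The facet criterion is indexed by half-spaces as sets, so normal and bound are
    recovered from the set.\<close>
  define rep where "rep = the_inv_into H ?half"
  have rep: "rep (?half h) = h" if "h \<in> H" for h
    unfolding rep_def by (rule the_inv_into_f_f[OF inj that])
  have aff: "affine hull ?S = UNIV"
    using interior_halfspaces[OF fin p] affine_hull_nonempty_interior by blast
  have "C facet_of ?S \<longleftrightarrow> (\<exists>h. h \<in> F \<and> C = ?S \<inter> {x. fst (rep h) \<bullet> x = snd (rep h)})" for C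
  proof (rule facet_of_polyhedron_explicit)
    show "finite F" using fin by (simp add: F_def)
    show "?S = affine hull ?S \<inter> \<Inter>F" unfolding aff F_def halfspaces_eq_Inter[symmetric] by simp
    show "fst (rep h) \<noteq> 0 \<and> h = {x. fst (rep h) \<bullet> x \<le> snd (rep h)}" if hF: "h \<in> F" for h
    proof -
      obtain k where "k \<in> H" "h = ?half k" using hF unfolding F_def by blast
      then show ?thesis using rep nz by simp
    qed
    show "?S \<subset> affine hull ?S \<inter> \<Inter>F'" if F': "F' \<subset> F" for F'
    proof -
      obtain k where k: "k \<in> H" "?half k \<notin> F'" using F' unfolding F_def by blast
      obtain y where y: "snd k < fst k \<bullet> y" "strictly (H - {k}) y" using viol[OF k(1)] by blast
      have "y \<notin> ?S" using y(1) k(1) by (force simp: halfspaces_def)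
      moreover have "y \<in> \<Inter>F'"
      proof
        fix f assume f: "f \<in> F'"
        then obtain h where h: "h \<in> H" "f = ?half h" using F' unfolding F_def by blast
        then have "h \<in> H - {k}" using f k by blast
        then show "y \<in> f" using y(2) h by (auto simp: strictly_def less_imp_le)
      qed
      moreover have "?S \<subseteq> \<Inter>F'" using F' unfolding halfspaces_eq_Inter F_def by blast
      ultimately show ?thesis unfolding aff by blast
    qed
  qed
  then have "{C. C facet_of ?S} = (\<lambda>f. ?S \<inter> {x. fst (rep f) \<bullet> x = snd (rep f)}) ` F" by blast
  also have "\<dots> = (\<lambda>h. ?S \<inter> {x. fst h \<bullet> x = snd h}) ` H"
    unfolding F_def image_image using rep by (intro image_cong) simp_all
  finally have "{C. C facet_of ?S} = (\<lambda>h. ?S \<inter> {x. fst h \<bullet> x = snd h}) ` H" .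
  moreover have "inj_on (\<lambda>h. ?S \<inter> {x. fst h \<bullet> x = snd h}) H"
  proof (rule inj_onI, rule ccontr)
    fix h k assume hk: "h \<in> H" "k \<in> H" "?S \<inter> {x. fst h \<bullet> x = snd h} = ?S \<inter> {x. fst k \<bullet> x = snd k}" "h \<noteq> k"
    have "q h \<in> ?S \<inter> {x. fst h \<bullet> x = snd h}" using qS q(1) hk(1) by simp
    then have "fst k \<bullet> q h = snd k" unfolding hk(3) by simp
    then show False using qlt[OF hk(1,2)] hk(4) by auto
  qed
  ultimately show ?thesis by (simp add: card_image)
qed

section \<open>Adding facets by cutting off vertices\<close>

lemma polyhedron_halfspaces:
  fixes H :: "('a::euclidean_space \<times> real) set"
  assumes "finite H"
  shows "polyhedron (halfspaces H)"
  unfolding halfspaces_eq_Inter using assms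
  by (intro polyhedron_Inter) (auto intro: polyhedron_halfspace_le)

text \<open>A point satisfying exactly one constraint with equality can be moved along its hyperplane.\<close>

lemma extreme_point_not_simply_tight:
  fixes H :: "('a::euclidean_space \<times> real) set"
  assumes fin: "finite H" and dim: "2 \<le> DIM('a)"
    and x: "x extreme_point_of halfspaces H" and h: "h \<in> H"
  shows "\<not> (fst h \<bullet> x = snd h \<and> strictly (H - {h}) x)"
proof
  assume t: "fst h \<bullet> x = snd h \<and> strictly (H - {h}) x"
  obtain u where u: "u \<noteq> 0" "orthogonal (fst h) u" using orthogonal_to_vector_exists[OF dim] by blast
  have "x \<in> interior (halfspaces (H - {h}))"
    using interior_halfspaces[of "H - {h}"] fin t by auto
  then obtain e where e: "e > 0" "ball x e \<subseteq> halfspaces (H - {h})"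
    unfolding mem_interior by blast
  define s where "s = e / (2 * norm u)"
  have s: "s > 0" "s * norm u < e" using e(1) u(1) by (auto simp: s_def)
  have "x + \<sigma> *\<^sub>R u \<in> halfspaces H" if "\<bar>\<sigma>\<bar> = s" for \<sigma>
  proof -
    have "x + \<sigma> *\<^sub>R u \<in> ball x e" using s that by (simp add: dist_norm)
    then have "x + \<sigma> *\<^sub>R u \<in> halfspaces (H - {h})" using e(2) by blast
    moreover have "fst h \<bullet> (x + \<sigma> *\<^sub>R u) = snd h"
      using t u(2) by (simp add: inner_add_right orthogonal_def)
    ultimately show ?thesis by (force simp: halfspaces_def)
  qed
  from this[of s] this[of "- s"] s(1)
  have "x + s *\<^sub>R u \<in> halfspaces H" "x - s *\<^sub>R u \<in> halfspaces H" by auto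
  moreover have "x \<in> open_segment (x + s *\<^sub>R u) (x - s *\<^sub>R u)"
  proof -
    have "x + s *\<^sub>R u \<noteq> x - s *\<^sub>R u"
    proof
      assume "x + s *\<^sub>R u = x - s *\<^sub>R u"
      then have "(2 * s) *\<^sub>R u = 0" by (simp add: algebra_simps flip: scaleR_2)
      then show False using s(1) u(1) by simp
    qed
    moreover have "midpoint (x + s *\<^sub>R u) (x - s *\<^sub>R u) = x"
      by (simp add: midpoint_def flip: scaleR_2)
    ultimately show ?thesis by (metis midpoint_in_open_segment)
  qed
  ultimately show False using x by (auto simp: extreme_point_of_def)
qed

text \<open>The minimizers of \<open>w\<close> form a nonempty face, and extreme points of a face
  are extreme points of \<open>P\<close>.\<close>

lemma extreme_point_minimizer:
  fixes P :: "'a::euclidean_space set"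
  assumes P: "polytope P" "p \<in> P"
  obtains x where "x extreme_point_of P" "w \<bullet> x \<le> w \<bullet> p"
proof -
  let ?M = "maximizers P (- w)"
  have "\<exists>x\<in>P. \<forall>y\<in>P. (- w) \<bullet> y \<le> (- w) \<bullet> x"
    using P polytope_imp_compact[OF P(1)]
    by (intro continuous_attains_sup continuous_intros) auto
  then have "?M \<noteq> {}" by (auto simp: maximizers_def)
  moreover have M: "?M face_of P" by (rule maximizers_face_of[OF polytope_imp_convex[OF P(1)]])
  then have "polytope ?M" using face_of_polytope_polytope P(1) by blast
  ultimately obtain x where "x extreme_point_of ?M"
    using extreme_point_exists_convex polytope_imp_compact polytope_imp_convex by blast
  then have "x extreme_point_of P" "x \<in> ?M" using extreme_point_of_face[OF M] by auto
  then show ?thesis using that[of x] P(2) by (auto simp: maximizers_def)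
qed

text \<open>A vertex \<open>x\<close> at or below the level of \<open>p\<close> is not in
  \<open>V\<close>. A hyperplane separating \<open>x\<close> from \<open>V\<close>, \<open>p\<close>
  and all old witnesses adds one irredundant constraint and leaves the others irredundant.\<close>

lemma cut_off_vertex:
  fixes H :: "('a::euclidean_space \<times> real) set"
  assumes fin: "finite H" and p: "strictly H p" and irr: "irredundant H"
    and bd: "bounded (halfspaces H)" and dim: "2 \<le> DIM('a)"
    and V: "finite V" "V \<subseteq> halfspaces H" "\<And>v. v \<in> V \<Longrightarrow> w \<bullet> p < w \<bullet> v"
  shows "\<exists>G. finite G \<and> strictly G p \<and> irredundant G \<and> halfspaces G \<subseteq> halfspaces H \<and>
           V \<subseteq> halfspaces G \<and> card G = Suc (card H)"
proof -
  let ?P = "halfspaces H"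
  have P: "polytope ?P" using polyhedron_halfspaces[OF fin] bd polytope_eq_bounded_polyhedron by blast
  have pP: "p \<in> ?P" using p by (rule strictly_imp_halfspaces)
  obtain x where x: "x extreme_point_of ?P" "w \<bullet> x \<le> w \<bullet> p"
    using extreme_point_minimizer[OF P pP] by blast
  have xP: "x \<in> ?P" using x(1) by (simp add: extreme_point_of_def)
  have "{x} exposed_face_of ?P"
    using x(1) exposed_face_of_polyhedron[OF polyhedron_halfspaces[OF fin]] face_of_singleton by blast
  then obtain a b where ab: "?P \<subseteq> {y. a \<bullet> y \<le> b}" "{x} = ?P \<inter> {y. a \<bullet> y = b}"
    unfolding exposed_face_of_def by blast
  have axb: "a \<bullet> x = b" using ab(2) by blast
  have lt: "a \<bullet> y < a \<bullet> x" if "y \<in> ?P" "y \<noteq> x" for y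
  proof -
    have "a \<bullet> y \<noteq> b" using ab(2) that by blast
    moreover have "a \<bullet> y \<le> b" using ab(1) that by blast
    ultimately show ?thesis using axb by simp
  qed
  have "\<exists>q. fst h \<bullet> q = snd h \<and> strictly (H - {h}) q" if "h \<in> H" for h
    using irr that unfolding irredundant_def by blast
  then obtain q where q: "\<And>h. h \<in> H \<Longrightarrow> fst h \<bullet> q h = snd h"
      "\<And>h. h \<in> H \<Longrightarrow> strictly (H - {h}) (q h)"
    by metis
  \<comment> \<open>The points to be kept. None equals \<open>x\<close>: those of \<open>V\<close>
    are higher, \<open>p\<close> is interior, and a witness is tight for a single constraint, which
    is impossible for a vertex in dimension at least 2.\<close>
  define Q where "Q = V \<union> insert p (q ` H)"
  have pv: "\<not> strictly H x"
  proof
    assume s: "strictly H x"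
    have "x \<in> interior ?P" using interior_halfspaces[OF fin s] .
    then show False using x(1) extreme_point_not_in_interior by blast
  qed
  have Q: "finite Q" "Q \<subseteq> ?P" "x \<notin> Q"
  proof -
    show "finite Q" using V fin by (simp add: Q_def)
    have "q h \<in> ?P" if "h \<in> H" for h
      using q[OF that] by (force simp: halfspaces_def strictly_def)
    then show "Q \<subseteq> ?P" using V pP by (auto simp: Q_def)
    have "x \<notin> V" using V(3) x(2) by fastforce
    moreover have "x \<noteq> p" using pv p by blast
    moreover have "x \<notin> q ` H"
      using extreme_point_not_simply_tight[OF fin dim x(1)] q by blast
    ultimately show "x \<notin> Q" by (auto simp: Q_def)
  qed
  have Qlt: "a \<bullet> y < a \<bullet> x" if "y \<in> Q" for y using lt Q that by blast
  define m where "m = Max ((\<lambda>y. a \<bullet> y) ` Q)"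
  have Qm: "a \<bullet> y \<le> m" if "y \<in> Q" for y
    unfolding m_def using Q(1) that by (intro Max_ge) auto
  have "m \<in> (\<lambda>y. a \<bullet> y) ` Q" unfolding m_def using Q(1) by (intro Max_in) (auto simp: Q_def)
  then have mx: "m < a \<bullet> x" using Qlt by auto
  define \<beta> where "\<beta> = (m + a \<bullet> x) / 2"
  have \<beta>: "m < \<beta>" "\<beta> < a \<bullet> x" using mx by (auto simp: \<beta>_def)
  have Q\<beta>: "a \<bullet> y < \<beta>" if "y \<in> Q" for y using Qm[OF that] \<beta> by simp
  define G where "G = insert (a, \<beta>) H"
  have new: "(a, \<beta>) \<notin> H" using xP \<beta>(2) by (force simp: halfspaces_def)
  have "irredundant G"
    unfolding irredundant_def
  proof
    fix h assume "h \<in> G"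
    then consider "h = (a, \<beta>)" | "h \<in> H" "h \<noteq> (a, \<beta>)" using new by (auto simp: G_def)
    then show "\<exists>r. fst h \<bullet> r = snd h \<and> strictly (G - {h}) r"
    proof cases
      case 1
      \<comment> \<open>The witness of the new constraint is where the segment from \<open>p\<close>
        to \<open>x\<close> meets the new hyperplane.\<close>
      have "a \<bullet> p < \<beta>" using Q\<beta> by (simp add: Q_def)
      then obtain t where t: "0 < t" "t < 1" "a \<bullet> ((1 - t) *\<^sub>R p + t *\<^sub>R x) = \<beta>"
        using \<beta>(2) by (rule hyperplane_crossing)
      have "strictly H ((1 - t) *\<^sub>R p + t *\<^sub>R x)"
        using strictly_between[OF p xP] t by auto
      then have "strictly (G - {h}) ((1 - t) *\<^sub>R p + t *\<^sub>R x)"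
        using 1 by (auto simp: strictly_def G_def)
      then show ?thesis using t(3) 1 by (intro exI[of _ "(1 - t) *\<^sub>R p + t *\<^sub>R x"]) simp
    next
      case 2
      have "a \<bullet> q h < \<beta>" using Q\<beta> 2 by (simp add: Q_def)
      then have "strictly (G - {h}) (q h)" using q(2)[OF 2(1)]
        by (auto simp: strictly_def G_def)
      then show ?thesis using q(1)[OF 2(1)] by blast
    qed
  qed
  moreover have "strictly G p" using p Q\<beta> by (auto simp: G_def strictly_def Q_def)
  moreover have "V \<subseteq> halfspaces G"
    using V(2) Q\<beta> by (force simp: G_def halfspaces_def Q_def)
  moreover have "halfspaces G \<subseteq> ?P" by (rule halfspaces_mono) (auto simp: G_def)
  moreover have "card G = Suc (card H)" "finite G" using new fin by (auto simp: G_def)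
  ultimately show ?thesis by blast
qed

text \<open>Redundant constraints are discarded first, which leaves at most \<open>N\<close> facets;
  each cut then raises the number by exactly one. The points of \<open>V\<close>, all above the
  level of \<open>p\<close>, are never cut away.\<close>

lemma polytope_with_facets:
  fixes H :: "('a::euclidean_space \<times> real) set"
  assumes fin: "finite H" and p: "strictly H p"
    and bd: "bounded (halfspaces H)" and dim: "2 \<le> DIM('a)"
    and V: "finite V" "V \<subseteq> halfspaces H" "\<And>v. v \<in> V \<Longrightarrow> w \<bullet> p < w \<bullet> v"
    and N: "card H \<le> N"
  shows "\<exists>P. polytope P \<and> aff_dim P = int DIM('a) \<and> card {F. F facet_of P} = N \<and>
           V \<subseteq> P \<and> P \<subseteq> halfspaces H"
proof -
  obtain G0 where G0: "G0 \<subseteq> H" "halfspaces G0 = halfspaces H" "irredundant G0"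
    using irredundant_subset_exists[OF fin p] by blast
  have c0: "finite G0" "card G0 \<le> N" "strictly G0 p"
    using G0 fin N card_mono[OF fin G0(1)] finite_subset strictly_mono[OF p] by auto
  have "\<exists>G. finite G \<and> strictly G p \<and> irredundant G \<and> halfspaces G \<subseteq> halfspaces H \<and>
           V \<subseteq> halfspaces G \<and> card G = card G0 + k" for k
  proof (induction k)
    case 0
    then show ?case using G0 c0 V by (intro exI[of _ G0]) auto
  next
    case (Suc k)
    then obtain G where G: "finite G" "strictly G p" "irredundant G"
      "halfspaces G \<subseteq> halfspaces H" "V \<subseteq> halfspaces G" "card G = card G0 + k" by blast
    obtain G' where "finite G' \<and> strictly G' p \<and> irredundant G' \<and> halfspaces G' \<subseteq> halfspaces G \<and>
           V \<subseteq> halfspaces G' \<and> card G' = Suc (card G)"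
      using cut_off_vertex[OF G(1-3) bounded_subset[OF bd G(4)] dim V(1) G(5) V(3)] by blast
    then show ?case using G by (intro exI[of _ G']) auto
  qed
  from this[of "N - card G0"] c0 obtain G where G: "finite G" "strictly G p" "irredundant G"
      "halfspaces G \<subseteq> halfspaces H" "V \<subseteq> halfspaces G" "card G = N" by auto
  have "polytope (halfspaces G)"
    using polyhedron_halfspaces[OF G(1)] bounded_subset[OF bd G(4)] polytope_eq_bounded_polyhedron by blast
  moreover have "aff_dim (halfspaces G) = int DIM('a)"
    using interior_halfspaces[OF G(1,2)] aff_dim_nonempty_interior by blast
  ultimately show ?thesis using facets_irredundant[OF G(1-3)] G by blast
qed

section \<open>Affine coordinates that turn plates into gadgets\<close>

section \<open>Plates\<close>

text \<open>The plate belongs to coordinate \<open>g j\<close>, and differences are taken against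
  \<open>g (Suc j)\<close>. The shifts make \<open>n k = 1\<close> for \<open>k < j\<close> and
  \<open>n j = - 3\<close> yield the vector \<open>1\<close>, which is the objective
  \<open>w\<close>.\<close>

definition plate_normal :: "(nat \<Rightarrow> 'n::finite) \<Rightarrow> nat \<Rightarrow> real \<Rightarrow> real \<Rightarrow> (nat \<Rightarrow> real) \<Rightarrow> real ^ 'n" where
  "plate_normal g j L r n =
     1 + (\<Sum>k<j. ((n k - 1) * L * r) *\<^sub>R (axis (g k) 1 - axis (g (Suc j)) 1))
       + ((n j + 3) * r) *\<^sub>R (axis (g j) 1 - axis (g (Suc j)) 1)"

definition plate_offset :: "nat \<Rightarrow> real \<Rightarrow> (nat \<Rightarrow> real) \<Rightarrow> real" where
  "plate_offset j r n = r\<^sup>2 / 2 - (n j + 3) * r\<^sup>2"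

text \<open>For positive \<open>L\<close>, \<open>r\<close> and bijective \<open>g\<close>, the
  entries up to \<open>j\<close> all vanish exactly at the points
  \<open>u *\<^sub>R 1 + r *\<^sub>R axis (g j) 1\<close>.\<close>

definition plate_y :: "(nat \<Rightarrow> 'n::finite) \<Rightarrow> nat \<Rightarrow> real \<Rightarrow> real \<Rightarrow> real ^ 'n \<Rightarrow> nat \<Rightarrow> real" where
  "plate_y g j L r v k =
     (if k < j then L * r * (v $ g k - v $ g (Suc j)) else r * (v $ g j - v $ g (Suc j) - r))"

text \<open>Chosen to make \<open>plate_normal_coordinates\<close> hold for all \<open>n\<close> at
  once. At the centre of the plate, where \<open>z\<close> and all \<open>y\<close> vanish, the
  entries of \<open>v\<close> sum to \<open>- r\<^sup>2 / 2\<close>.\<close>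

definition plate_z :: "(nat \<Rightarrow> 'n::finite) \<Rightarrow> nat \<Rightarrow> real \<Rightarrow> real \<Rightarrow> real ^ 'n \<Rightarrow> real" where
  "plate_z g j L r v =
     (\<Sum>i\<in>UNIV. v $ i) - (\<Sum>k<j. plate_y g j L r v k) + 3 * plate_y g j L r v j + r\<^sup>2 / 2"

text \<open>The factor \<open>\<epsilon>\<close> on the right-hand sides shrinks the gadget towards
  the centre of the plate.\<close>

definition plate_constraints ::
    "(nat \<Rightarrow> 'n::finite) \<Rightarrow> nat \<Rightarrow> real \<Rightarrow> real \<Rightarrow> real \<Rightarrow> ((nat \<Rightarrow> real) \<times> real) set \<Rightarrow> ((real ^ 'n) \<times> real) set" where
  "plate_constraints g j L r \<epsilon> T =
     (\<lambda>(n, b). (plate_normal g j L r n, \<epsilon> * b - plate_offset j r n)) ` T"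

lemma one_inner_vec: "(1 :: real ^ 'n) \<bullet> v = (\<Sum>i\<in>UNIV. v $ i)"
  by (simp add: inner_vec_def)

lemma plate_normal_inner:
  "plate_normal g j L r n \<bullet> v =
     (\<Sum>i\<in>UNIV. v $ i) + (\<Sum>k<j. (n k - 1) * plate_y g j L r v k)
       + (n j + 3) * plate_y g j L r v j + (n j + 3) * r\<^sup>2"
proof -
  have "(\<Sum>k<j. (n k - 1) * plate_y g j L r v k) =
      (\<Sum>k<j. (n k - 1) * L * r * (v $ g k - v $ g (Suc j)))"
    by (intro sum.cong) (auto simp: plate_y_def)
  then show ?thesis
    by (simp add: plate_normal_def inner_add_left inner_sum_left inner_diff_left one_inner_vec
        inner_axis' plate_y_def power2_eq_square algebra_simps)
qed

lemma plate_normal_coordinates: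
  "plate_normal g j L r n \<bullet> v + plate_offset j r n =
     plate_z g j L r v + (\<Sum>k\<le>j. n k * plate_y g j L r v k)"
  unfolding plate_normal_inner plate_z_def plate_offset_def lessThan_Suc_atMost[symmetric]
  by (simp add: algebra_simps sum_subtractf)

text \<open>The \<open>y\<close> coordinates determine all differences from the entry at
  \<open>g (Suc j)\<close>, then \<open>z\<close> determines the sum of the entries, and together
  these fix that entry.\<close>

lemma plate_coordinates_inject:
  fixes v v' :: "real ^ 'n::finite"
  assumes g: "bij_betw g {..Suc j} (UNIV :: 'n set)" and "L > 0" "r > 0"
    and z: "plate_z g j L r v = plate_z g j L r v'"
    and y: "\<And>k. k \<le> j \<Longrightarrow> plate_y g j L r v k = plate_y g j L r v' k"
  shows "v = v'"
proof -
  let ?a = "v $ g (Suc j)" and ?a' = "v' $ g (Suc j)"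
  have d: "v $ g k - ?a = v' $ g k - ?a'" if k: "k \<le> Suc j" for k
  proof -
    consider "k < j" | "k = j" | "k = Suc j" using k by linarith
    then show ?thesis using y[of k] assms(2,3) by cases (auto simp: plate_y_def)
  qed
  have di: "v $ i - ?a = v' $ i - ?a'" for i
  proof -
    have "i \<in> g ` {..Suc j}" using g by (simp add: bij_betw_def)
    then show ?thesis using d by auto
  qed
  have "(\<Sum>k<j. plate_y g j L r v k) = (\<Sum>k<j. plate_y g j L r v' k)"
    using y by (intro sum.cong) auto
  then have S: "(\<Sum>i\<in>UNIV. v $ i) = (\<Sum>i\<in>UNIV. v' $ i)"
    using z y[of j] unfolding plate_z_def by simp
  have "(\<Sum>i\<in>UNIV. v $ i - ?a) = (\<Sum>i\<in>UNIV. v' $ i - ?a')" using di by simp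
  then have "of_nat CARD('n) * ?a = of_nat CARD('n) * ?a'"
    using S by (simp add: sum_subtractf)
  then have "?a = ?a'" by simp
  then show ?thesis using di by (simp add: vec_eq_iff)
qed

text \<open>The inverse of the coordinate map: \<open>u\<close> is the entry at
  \<open>g (Suc j)\<close>, solved from the prescribed sum of all \<open>j + 2\<close> entries, and
  \<open>h\<close> holds the differences from it.\<close>

definition plate_point :: "(nat \<Rightarrow> 'n::finite) \<Rightarrow> nat \<Rightarrow> real \<Rightarrow> real \<Rightarrow> real \<Rightarrow> (nat \<Rightarrow> real) \<Rightarrow> real ^ 'n" where
  "plate_point g j L r z y =
     (let h = (\<lambda>k. if k < j then y k / (L * r) else if k = j then r + y j / r else 0);
          u = (z - r\<^sup>2 / 2 - 3 * y j + (\<Sum>k<j. y k) - (\<Sum>k<j. y k / (L * r)) - (r + y j / r))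
                / real (j + 2)
      in \<chi> i. u + h (inv_into {..Suc j} g i))"

lemma plate_point_coordinates:
  fixes g :: "nat \<Rightarrow> 'n::finite"
  assumes g: "bij_betw g {..Suc j} (UNIV :: 'n set)" and L: "L > 0" and r: "r > 0"
  shows "plate_z g j L r (plate_point g j L r z y) = z"
    and "\<And>k. k \<le> j \<Longrightarrow> plate_y g j L r (plate_point g j L r z y) k = y k"
proof -
  define h where "h = (\<lambda>k. if k < j then y k / (L * r) else if k = j then r + y j / r else 0)"
  define u where "u = (z - r\<^sup>2 / 2 - 3 * y j + (\<Sum>k<j. y k) - (\<Sum>k<j. y k / (L * r)) - (r + y j / r))
                / real (j + 2)"
  let ?v = "plate_point g j L r z y"
  have v: "?v $ g k = u + h k" if "k \<le> Suc j" for k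
    using bij_betw_inv_into_left[OF g, of k] that
    by (simp add: plate_point_def h_def u_def Let_def)
  have yv: "plate_y g j L r ?v k = y k" if "k \<le> j" for k
  proof (cases "k < j")
    case True
    then show ?thesis using v[of k] v[of "Suc j"] L r by (simp add: plate_y_def h_def)
  next
    case False
    then have "k = j" using that by simp
    then show ?thesis using v[of j] v[of "Suc j"] L r by (simp add: plate_y_def h_def)
  qed
  then show "\<And>k. k \<le> j \<Longrightarrow> plate_y g j L r ?v k = y k" .
  have "(\<Sum>i\<in>UNIV. ?v $ i) = (\<Sum>k\<le>Suc j. ?v $ g k)"
    by (rule sum.reindex_bij_betw[OF g, symmetric])
  also have "\<dots> = (\<Sum>k\<le>Suc j. u + h k)" using v by (intro sum.cong) auto
  also have "\<dots> = real (j + 2) * u + (\<Sum>k\<le>Suc j. h k)" by (simp add: sum.distrib)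
  also have "(\<Sum>k\<le>Suc j. h k) = (\<Sum>k<j. y k / (L * r)) + (r + y j / r)"
    by (simp add: h_def lessThan_Suc_atMost[symmetric])
  also have "real (j + 2) * u = z - r\<^sup>2 / 2 - 3 * y j + (\<Sum>k<j. y k) - (\<Sum>k<j. y k / (L * r)) - (r + y j / r)"
    unfolding u_def by (simp only: times_divide_eq_right) simp
  finally have S: "(\<Sum>i\<in>UNIV. ?v $ i) = z - r\<^sup>2 / 2 - 3 * y j + (\<Sum>k<j. y k)" by simp
  have "(\<Sum>k<j. plate_y g j L r ?v k) = (\<Sum>k<j. y k)" using yv by (intro sum.cong) auto
  then show "plate_z g j L r ?v = z" unfolding plate_z_def S using yv[of j] by simp
qed

lemma plate_point_mem:
  fixes g :: "nat \<Rightarrow> 'n::finite"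
  assumes g: "bij_betw g {..Suc j} (UNIV :: 'n set)" and L: "L > 0" and r: "r > 0"
    and \<epsilon>: "\<epsilon> > 0" and sat: "satisfies j T z y"
  shows "plate_point g j L r (\<epsilon> * z) (\<lambda>k. \<epsilon> * y k) \<in> halfspaces (plate_constraints g j L r \<epsilon> T)"
proof -
  let ?v = "plate_point g j L r (\<epsilon> * z) (\<lambda>k. \<epsilon> * y k)"
  have "plate_normal g j L r n \<bullet> ?v \<le> \<epsilon> * b - plate_offset j r n" if "(n, b) \<in> T" for n b
  proof -
    have "plate_normal g j L r n \<bullet> ?v + plate_offset j r n = \<epsilon> * (z + (\<Sum>k\<le>j. n k * y k))"
      unfolding plate_normal_coordinates
      by (simp add: plate_point_coordinates[OF g L r] distrib_left sum_distrib_left mult.left_commute)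
    also have "\<dots> \<le> \<epsilon> * b"
      using sat that \<epsilon> by (intro mult_left_mono) (auto simp: satisfies_def)
    finally show ?thesis by simp
  qed
  then show ?thesis by (auto simp: halfspaces_def plate_constraints_def)
qed

text \<open>A vector with sum 0 is a combination of the differences
  \<open>axis (g k) 1 - axis (g (Suc j)) 1\<close>, so tilting \<open>w\<close> only changes the
  gadget coefficients.\<close>

lemma plate_normal_objective:
  fixes c :: "real ^ 'n::finite"
  assumes g: "bij_betw g {..Suc j} (UNIV :: 'n set)" and L: "L > 0" and r: "r > 0"
    and c: "(\<Sum>i\<in>UNIV. c $ i) = 0"
  shows "plate_normal g j L r (\<lambda>k. if k < j then 1 + c $ g k / (L * r) else c $ g j / r - 3) = 1 + c"
proof -
  let ?e = "\<lambda>k. axis (g k) 1 :: real ^ 'n"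
  have "(\<Sum>k\<le>Suc j. c $ g k) = 0"
    using sum.reindex_bij_betw[OF g, of "\<lambda>i. c $ i"] c by simp
  then have last: "c $ g (Suc j) = - (\<Sum>k\<le>j. c $ g k)" by simp
  have "c = (\<Sum>i\<in>UNIV. (c $ i) *\<^sub>R axis i 1)"
    by (simp add: vec_eq_iff axis_def if_distrib cong: if_cong)
  also have "\<dots> = (\<Sum>k\<le>Suc j. (c $ g k) *\<^sub>R ?e k)"
    by (rule sum.reindex_bij_betw[OF g, symmetric])
  also have "\<dots> = (\<Sum>k\<le>j. (c $ g k) *\<^sub>R (?e k - ?e (Suc j)))"
    by (simp add: last scaleR_diff_right sum_subtractf scaleR_sum_left)
  also have "\<dots> = (\<Sum>k<j. (c $ g k) *\<^sub>R (?e k - ?e (Suc j))) + (c $ g j) *\<^sub>R (?e j - ?e (Suc j))"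
    by (simp add: lessThan_Suc_atMost[symmetric])
  finally have e: "c = (\<Sum>k<j. (c $ g k) *\<^sub>R (?e k - ?e (Suc j))) + (c $ g j) *\<^sub>R (?e j - ?e (Suc j))" .
  have "(\<Sum>k<j. (((if k < j then 1 + c $ g k / (L * r) else c $ g j / r - 3) - 1) * L * r) *\<^sub>R (?e k - ?e (Suc j)))
      = (\<Sum>k<j. (c $ g k) *\<^sub>R (?e k - ?e (Suc j)))"
    using L r by (intro sum.cong) auto
  moreover have "(c $ g j / r - 3 + 3) * r = c $ g j" using r by simp
  ultimately show ?thesis unfolding plate_normal_def using e by (simp add: add.assoc)
qed

text \<open>The negative of an entry is the sum of all the others, each at most
  \<open>a\<close>.\<close>

lemma sum_zero_abs_le:
  fixes c :: "real ^ 'n::finite"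
  assumes "(\<Sum>i\<in>UNIV. c $ i) = 0" "\<And>k. c $ k \<le> a"
  shows "\<bar>c $ m\<bar> \<le> real CARD('n) * a"
proof -
  have S: "c $ m + (\<Sum>i\<in>UNIV - {m}. c $ i) = 0"
    using assms(1) sum.remove[of UNIV m "\<lambda>i. c $ i"] by simp
  have a: "a \<ge> 0"
  proof (rule ccontr)
    assume "\<not> a \<ge> 0"
    then have "\<And>i. c $ i < 0" using assms(2) by (meson le_less_trans not_le)
    then have "(\<Sum>i\<in>UNIV. c $ i) < 0"
      using sum_strict_mono[of UNIV "\<lambda>i. c $ i" "\<lambda>_. 0"] by simp
    then show False using assms(1) by simp
  qed
  have "(\<Sum>i\<in>UNIV - {m}. c $ i) \<le> of_nat (card (UNIV - {m} :: 'n set)) * a"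
    by (rule sum_bounded_above) (rule assms(2))
  also have "\<dots> \<le> real CARD('n) * a" using a by (intro mult_right_mono) auto
  finally have "- (c $ m) \<le> real CARD('n) * a" using S by simp
  moreover have "c $ m \<le> real CARD('n) * a"
  proof -
    have "c $ m \<le> 1 * a" using assms(2) by simp
    also have "\<dots> \<le> real CARD('n) * a" using a by (intro mult_right_mono) (auto simp: Suc_le_eq)
    finally show ?thesis .
  qed
  ultimately show ?thesis by simp
qed

text \<open>The single parameter \<open>\<mu>\<close> is spent on the last gadget coefficient; the
  others stay within \<open>\<delta>\<close> of 1 because \<open>L\<close> is large.\<close>

lemma plate_point_exposed:
  fixes g :: "nat \<Rightarrow> 'n::finite" and c :: "real ^ 'n"
  assumes g: "bij_betw g {..Suc j} (UNIV :: 'n set)" and L: "L > 0" and r: "r > 0" and \<epsilon>: "\<epsilon> > 0"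
    and exp: "exposed_near j T s \<delta> z y" and s: "\<bar>s\<bar> < 1" and \<delta>: "\<delta> > 0"
    and large: "4 * real CARD('n) \<le> \<delta> * L"
    and c: "(\<Sum>i\<in>UNIV. c $ i) = 0" "c \<noteq> 0" "\<And>k. c $ k \<le> c $ g j"
  shows "\<exists>\<mu>>0. \<forall>x\<in>halfspaces (plate_constraints g j L r \<epsilon> T).
           (1 + \<mu> *\<^sub>R c) \<bullet> x \<le> (1 + \<mu> *\<^sub>R c) \<bullet> plate_point g j L r (\<epsilon> * z) (\<lambda>k. \<epsilon> * y k) \<and>
           ((1 + \<mu> *\<^sub>R c) \<bullet> x = (1 + \<mu> *\<^sub>R c) \<bullet> plate_point g j L r (\<epsilon> * z) (\<lambda>k. \<epsilon> * y k) \<longrightarrow>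
              x = plate_point g j L r (\<epsilon> * z) (\<lambda>k. \<epsilon> * y k))"
proof -
  let ?X = "plate_point g j L r (\<epsilon> * z) (\<lambda>k. \<epsilon> * y k)"
  have pos: "c $ g j > 0"
  proof (rule ccontr)
    assume "\<not> ?thesis"
    then have le: "c $ k \<le> 0" for k using c(3)[of k] by linarith
    have "\<bar>c $ m\<bar> \<le> real CARD('n) * 0" for m by (rule sum_zero_abs_le[OF c(1) le])
    then have "c = 0" by (simp add: vec_eq_iff)
    then show False using c(2) by simp
  qed
  \<comment> \<open>Makes the last coefficient \<open>\<mu> * c $ g j / r - 3\<close> equal to
    \<open>s\<close>.\<close>
  define \<mu> where "\<mu> = r * (3 + s) / c $ g j"
  have \<mu>: "\<mu> > 0" using r s pos by (simp add: \<mu>_def)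
  define d where "d = \<mu> *\<^sub>R c"
  define A where "A = (\<lambda>k. if k < j then 1 + d $ g k / (L * r) else d $ g j / r - 3)"
  have d0: "(\<Sum>i\<in>UNIV. d $ i) = 0"
    using c(1) by (simp add: d_def sum_distrib_left[symmetric])
  have dj: "d $ g j = r * (3 + s)" using pos by (simp add: d_def \<mu>_def)
  have dk: "d $ k \<le> r * 4" for k
  proof -
    have "d $ k \<le> d $ g j" using c(3)[of k] \<mu> by (simp add: d_def)
    also have "\<dots> \<le> r * 4" unfolding dj using r s by (intro mult_left_mono) auto
    finally show ?thesis .
  qed
  have Aj: "\<bar>A j - s\<bar> \<le> \<delta>" using dj r \<delta> by (simp add: A_def)
  \<comment> \<open>No entry of \<open>d\<close> exceeds \<open>4 * r\<close>, so absolute values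
    are at most \<open>4 * r\<close> times the dimension. Division by \<open>L * r\<close> cancels
    the radius, so the same \<open>L\<close> serves all plates.\<close>
  have Ak: "\<bar>A k - 1\<bar> \<le> \<delta>" if "k < j" for k
  proof -
    have "\<bar>d $ g k\<bar> \<le> real CARD('n) * (r * 4)" by (rule sum_zero_abs_le[OF d0 dk])
    also have "\<dots> = (4 * real CARD('n)) * r" by simp
    also have "\<dots> \<le> (\<delta> * L) * r" using large r by (intro mult_right_mono) auto
    finally show ?thesis using that L r by (simp add: A_def abs_divide divide_le_eq mult.assoc)
  qed
  have obj: "(1 + d) \<bullet> x = plate_z g j L r x + (\<Sum>k\<le>j. A k * plate_y g j L r x k) - plate_offset j r A" for x
    using plate_normal_coordinates[of g j L r A x] plate_normal_objective[OF g L r d0]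
    unfolding A_def by simp
  have "(1 + d) \<bullet> x \<le> (1 + d) \<bullet> ?X \<and> ((1 + d) \<bullet> x = (1 + d) \<bullet> ?X \<longrightarrow> x = ?X)"
    if x: "x \<in> halfspaces (plate_constraints g j L r \<epsilon> T)" for x
  proof -
    define z' where "z' = plate_z g j L r x / \<epsilon>"
    define y' where "y' k = plate_y g j L r x k / \<epsilon>" for k
    have zx: "plate_z g j L r x = \<epsilon> * z'" and yx: "plate_y g j L r x k = \<epsilon> * y' k" for k
      using \<epsilon> by (simp_all add: z'_def y'_def)
    have "z' + (\<Sum>k\<le>j. n k * y' k) \<le> b" if "(n, b) \<in> T" for n b
    proof -
      have "plate_normal g j L r n \<bullet> x + plate_offset j r n \<le> \<epsilon> * b"
        using x that by (force simp: halfspaces_def plate_constraints_def)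
      then have "\<epsilon> * (z' + (\<Sum>k\<le>j. n k * y' k)) \<le> \<epsilon> * b"
        unfolding plate_normal_coordinates zx yx
        by (simp add: distrib_left sum_distrib_left mult.left_commute)
      then show ?thesis using \<epsilon> by simp
    qed
    then have "satisfies j T z' y'" by (auto simp: satisfies_def)
    then have le: "z' + (\<Sum>k\<le>j. A k * y' k) \<le> z + (\<Sum>k\<le>j. A k * y k)"
      and eq: "z' + (\<Sum>k\<le>j. A k * y' k) = z + (\<Sum>k\<le>j. A k * y k) \<longrightarrow> z' = z \<and> (\<forall>k\<le>j. y' k = y k)"
      using exp Ak Aj unfolding exposed_near_def by blast+
    have ox: "(1 + d) \<bullet> x = \<epsilon> * (z' + (\<Sum>k\<le>j. A k * y' k)) - plate_offset j r A"
      unfolding obj zx yx by (simp add: distrib_left sum_distrib_left mult.left_commute)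
    have oX: "(1 + d) \<bullet> ?X = \<epsilon> * (z + (\<Sum>k\<le>j. A k * y k)) - plate_offset j r A"
      unfolding obj by (simp add: plate_point_coordinates[OF g L r] distrib_left sum_distrib_left mult.left_commute)
    show ?thesis
    proof (intro conjI impI)
      show "(1 + d) \<bullet> x \<le> (1 + d) \<bullet> ?X" unfolding ox oX using le \<epsilon> by simp
      assume "(1 + d) \<bullet> x = (1 + d) \<bullet> ?X"
      then have "z' + (\<Sum>k\<le>j. A k * y' k) = z + (\<Sum>k\<le>j. A k * y k)" unfolding ox oX using \<epsilon> by simp
      then have zy: "z' = z" "\<And>k. k \<le> j \<Longrightarrow> y' k = y k" using eq by blast+
      show "x = ?X"
      proof (rule plate_coordinates_inject[OF g L r])
        show "plate_z g j L r x = plate_z g j L r ?X"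
          unfolding zx by (simp add: plate_point_coordinates[OF g L r] zy)
        show "plate_y g j L r x k = plate_y g j L r ?X k" if "k \<le> j" for k
          unfolding yx using that by (simp add: plate_point_coordinates[OF g L r] zy)
      qed
    qed
  qed
  then show ?thesis using \<mu> unfolding d_def by blast
qed

lemma plate_points_inj:
  fixes g :: "nat \<Rightarrow> 'n::finite"
  assumes g: "bij_betw g {..Suc j} (UNIV :: 'n set)" and L: "L > 0" and r: "r > 0" and \<epsilon>: "\<epsilon> > 0"
    and V: "\<And>z y. (z, y) \<in> V \<Longrightarrow> \<forall>k>j. y k = (0::real)"
  shows "inj_on (\<lambda>(z, y). plate_point g j L r (\<epsilon> * z) (\<lambda>k. \<epsilon> * y k)) V"
proof (rule inj_onI, clarify)
  fix z y z' y' assume v: "(z, y) \<in> V" "(z', y') \<in> V"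
    and e: "plate_point g j L r (\<epsilon> * z) (\<lambda>k. \<epsilon> * y k) = plate_point g j L r (\<epsilon> * z') (\<lambda>k. \<epsilon> * y' k)"
  note co = plate_point_coordinates[OF g L r]
  have "\<epsilon> * z = \<epsilon> * z'"
    by (metis co(1) e)
  moreover have "y k = y' k" for k
  proof (cases "k \<le> j")
    case True
    then show ?thesis
      using co(2)[of k "\<epsilon> * z" "\<lambda>k. \<epsilon> * y k"] co(2)[of k "\<epsilon> * z'" "\<lambda>k. \<epsilon> * y' k"]
      unfolding e using \<epsilon> by simp
  qed (use V[OF v(1)] V[OF v(2)] in auto)
  ultimately show "z = z' \<and> y = y'" using \<epsilon> by auto
qed

section \<open>Separating the plates from each other\<close>

text \<open>
  The quadratic terms come from the points \<open>r e\<^sub>i\<close> carrying the weight \<open>- r\<^sup>2 / 2\<close>, as for tangent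
  planes of a paraboloid; the mixed term is dominated because the radii are far apart.
\<close>

lemma other_plate_strict:
  fixes g g' :: "nat \<Rightarrow> 'n::finite"
  assumes g: "bij_betw g {..Suc j} (UNIV :: 'n set)" and g': "bij_betw g' {..Suc j} (UNIV :: 'n set)"
    and ne: "g j \<noteq> g' j" and L: "L > 0" and r: "r > 0" "r' > 0"
    and n: "- 2 \<le> n j" "\<And>k. k < j \<Longrightarrow> \<bar>n k - 1\<bar> \<le> R" and R: "R \<ge> 0"
    and far: "2 * (real j * (R * L)) * r' \<le> r \<or> 2 * (real j * (R * L)) * r \<le> r'"
  shows "plate_normal g' j L r' n \<bullet> plate_point g j L r 0 (\<lambda>_. 0) + plate_offset j r' n < 0"
proof -
  let ?X = "plate_point g j L r 0 (\<lambda>_. 0)"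
  have co: "plate_z g j L r ?X = 0" "\<And>k. k \<le> j \<Longrightarrow> plate_y g j L r ?X k = 0"
    by (simp_all add: plate_point_coordinates[OF g L r(1)])
  define u where "u = ?X $ g (Suc j)"
  have yk: "?X $ g k = u" if "k < j" for k
    using co(2)[of k] that L r by (simp add: plate_y_def u_def)
  have yj: "?X $ g j = u + r" using co(2)[of j] r by (simp add: plate_y_def u_def)
  \<comment> \<open>The centre of the plate: one entry is \<open>u + r\<close>, all others are
    \<open>u\<close>.\<close>
  have X: "?X $ i = (if i = g j then u + r else u)" for i
  proof -
    have "i \<in> g ` {..Suc j}" using g by (simp add: bij_betw_def)
    then obtain k where k: "k \<le> Suc j" "i = g k" by auto
    then consider "k < j" | "k = j" | "k = Suc j" by linarith
    then show ?thesis
    proof cases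
      case 1
      then have "g k \<noteq> g j" using inj_on_eq_iff[OF bij_betw_imp_inj_on[OF g], of k j] by simp
      then show ?thesis using yk[OF 1] k by simp
    next
      case 2 then show ?thesis using yj k by simp
    next
      case 3
      then have "g k \<noteq> g j" using inj_on_eq_iff[OF bij_betw_imp_inj_on[OF g], of k j] by simp
      then show ?thesis using 3 k by (simp add: u_def)
    qed
  qed
  have "(\<Sum>k<j. plate_y g j L r ?X k) = 0" using co(2) by (intro sum.neutral) auto
  then have S: "(\<Sum>i\<in>UNIV. ?X $ i) = - (r\<^sup>2 / 2)"
    using co(1) co(2)[of j] unfolding plate_z_def by simp
  have "(\<Sum>k<j. (n k - 1) * plate_y g' j L r' ?X k) \<le> (\<Sum>k<j. R * (L * r' * r))"
  proof (intro sum_mono)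
    fix k assume "k \<in> {..<j}"
    then have k: "k < j" by simp
    have "\<bar>plate_y g' j L r' ?X k\<bar> \<le> L * r' * r"
    proof -
      have "\<bar>?X $ g' k - ?X $ g' (Suc j)\<bar> \<le> r" unfolding X using r by auto
      then show ?thesis using k L r by (simp add: plate_y_def abs_mult)
    qed
    then have "\<bar>n k - 1\<bar> * \<bar>plate_y g' j L r' ?X k\<bar> \<le> R * (L * r' * r)"
      using n(2)[OF k] R by (intro mult_mono) auto
    then show "(n k - 1) * plate_y g' j L r' ?X k \<le> R * (L * r' * r)"
      unfolding abs_mult[symmetric] by simp
  qed
  then have mixed: "(\<Sum>k<j. (n k - 1) * plate_y g' j L r' ?X k) \<le> real j * (R * L) * r' * r"
    by (simp add: mult.assoc)
  \<comment> \<open>As \<open>g' j \<noteq> g j\<close>, the entry at \<open>g' j\<close> has the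
    smallest value \<open>u\<close>, so its difference from any other is nonpositive.\<close>
  have "plate_y g' j L r' ?X j \<le> - r'\<^sup>2"
  proof -
    have "?X $ g' j - ?X $ g' (Suc j) - r' \<le> - r'" unfolding X using r ne by auto
    then have "r' * (?X $ g' j - ?X $ g' (Suc j) - r') \<le> r' * (- r')"
      using r by (intro mult_left_mono) auto
    then show ?thesis by (simp add: plate_y_def power2_eq_square)
  qed
  moreover have "(n j + 3) * plate_y g' j L r' ?X j \<le> 1 * plate_y g' j L r' ?X j"
    using n(1) calculation by (intro mult_right_mono_neg) (auto intro: order_trans)
  ultimately have last: "(n j + 3) * plate_y g' j L r' ?X j \<le> - r'\<^sup>2" by simp
  \<comment> \<open>The terms \<open>(n j + 3) * r'\<^sup>2\<close> cancel, and everything except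
    the mixed sum is then at most \<open>- r\<^sup>2 / 2 - r'\<^sup>2 / 2\<close>.\<close>
  have small: "real j * (R * L) * r' * r < r\<^sup>2 / 2 + r'\<^sup>2 / 2"
    using far
  proof
    assume "2 * (real j * (R * L)) * r' \<le> r"
    then have "2 * (real j * (R * L)) * r' * r \<le> r * r" using r by (intro mult_right_mono) auto
    moreover have "r'\<^sup>2 > 0" using r by simp
    ultimately show ?thesis by (simp add: power2_eq_square)
  next
    assume "2 * (real j * (R * L)) * r \<le> r'"
    then have "2 * (real j * (R * L)) * r * r' \<le> r' * r'" using r by (intro mult_right_mono) auto
    moreover have "r\<^sup>2 > 0" using r by simp
    ultimately show ?thesis by (simp add: power2_eq_square ac_simps)
  qed
  show ?thesis
    unfolding plate_normal_inner S plate_offset_def using mixed last small by linarith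
qed

section \<open>All plates in one bounded system\<close>

section \<open>Arrangement of the plates\<close>

text \<open>Strict inequalities valid at the centre of a plate thus hold at its points once
  \<open>\<epsilon>\<close> is small.\<close>

lemma tendsto_plate_point:
  "((\<lambda>\<epsilon>. plate_point g j L r (\<epsilon> * z) (\<lambda>k. \<epsilon> * y k)) \<longlongrightarrow> plate_point g j L r 0 (\<lambda>_. 0)) (at_right 0)"
proof (rule vec_tendstoI)
  fix i
  let ?k = "inv_into {..Suc j} g i"
  let ?u = "\<lambda>\<epsilon>. (\<epsilon> * z - r\<^sup>2 / 2 - 3 * (\<epsilon> * y j) + (\<Sum>k<j. \<epsilon> * y k) - (\<Sum>k<j. \<epsilon> * y k / (L * r))
                  - (r + \<epsilon> * y j / r)) / real (j + 2)"
  let ?h = "\<lambda>\<epsilon>. if ?k < j then \<epsilon> * y ?k / (L * r) else if ?k = j then r + \<epsilon> * y j / r else 0"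
  have div: "((\<lambda>\<epsilon>. \<epsilon> * a / b) \<longlongrightarrow> 0 * a / b) (at_right 0)" for a b :: real
    unfolding times_divide_eq_right[symmetric] by (intro tendsto_intros)
  have u: "(?u \<longlongrightarrow> ?u 0) (at_right 0)"
    by (intro tendsto_intros div) auto
  have h: "(?h \<longlongrightarrow> ?h 0) (at_right 0)"
    using div[of "y ?k" "L * r"] tendsto_add[OF tendsto_const div[of "y j" r], of r] by auto
  have "plate_point g j L r (\<epsilon> * z) (\<lambda>k. \<epsilon> * y k) $ i = ?u \<epsilon> + ?h \<epsilon>" for \<epsilon>
    by (simp only: plate_point_def Let_def vec_lambda_beta)
  moreover have "plate_point g j L r 0 (\<lambda>_. 0) $ i = ?u 0 + ?h 0"
    by (simp add: plate_point_def Let_def)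
  ultimately show "((\<lambda>\<epsilon>. plate_point g j L r (\<epsilon> * z) (\<lambda>k. \<epsilon> * y k) $ i) \<longlongrightarrow> plate_point g j L r 0 (\<lambda>_. 0) $ i) (at_right 0)"
    using tendsto_add[OF u h] by (simp only:)
qed

text \<open>The lower bound on the coordinate sum turns each tilted bound into an upper bound on the
  deviation of \<open>x $ i\<close> from the mean. Deviations sum to 0, so they are bounded below
  too, and a tilted bound then limits the sum from above.\<close>

lemma bounded_by_tilted_objectives:
  fixes P :: "(real ^ 'n::finite) set"
  assumes low: "\<And>x. x \<in> P \<Longrightarrow> - K \<le> 1 \<bullet> x"
    and up: "\<And>i. \<exists>\<mu>>0. \<exists>B. \<forall>x\<in>P. (1 + \<mu> *\<^sub>R (axis i 1 - (1 / real CARD('n)) *\<^sub>R 1)) \<bullet> x \<le> B"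
  shows "bounded P"
proof -
  let ?C = "real CARD('n)"
  let ?m = "\<lambda>x :: real ^ 'n. (1 \<bullet> x) / ?C"
  obtain \<mu> B where \<mu>: "\<And>i. \<mu> i > (0 :: real)"
    and B: "\<And>i x. x \<in> P \<Longrightarrow> (1 + \<mu> i *\<^sub>R (axis i 1 - (1 / ?C) *\<^sub>R 1)) \<bullet> x \<le> B i"
    using up by metis
  have B': "1 \<bullet> x + \<mu> i * (x $ i - ?m x) \<le> B i" if "x \<in> P" for x i
    using B[OF that, of i] by (simp add: inner_add_left inner_diff_left inner_axis')
  define b where "b = (\<Sum>i\<in>UNIV. \<bar>B i + K\<bar> / \<mu> i)"
  have dev: "x $ i - ?m x \<le> b" if x: "x \<in> P" for x i
  proof -
    have "\<mu> i * (x $ i - ?m x) \<le> \<bar>B i + K\<bar>" using B'[OF x, of i] low[OF x] by linarith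
    then have "x $ i - ?m x \<le> \<bar>B i + K\<bar> / \<mu> i" using \<mu>[of i] by (simp add: pos_le_divide_eq mult.commute)
    also have "\<dots> \<le> b" unfolding b_def using \<mu>
      by (intro member_le_sum) (auto simp: less_imp_le)
    finally show ?thesis .
  qed
  have absdev: "\<bar>x $ i - ?m x\<bar> \<le> ?C * b" if x: "x \<in> P" for x i
  proof -
    have "(\<Sum>i\<in>UNIV. (x - ?m x *\<^sub>R 1) $ i) = 0"
      by (simp add: sum_subtractf one_inner_vec)
    moreover have "(x - ?m x *\<^sub>R 1) $ k \<le> b" for k using dev[OF x] by simp
    ultimately have "\<bar>(x - ?m x *\<^sub>R 1) $ i\<bar> \<le> ?C * b" by (rule sum_zero_abs_le)
    then show ?thesis by simp
  qed
  \<comment> \<open>An arbitrary coordinate.\<close>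
  define i0 where "i0 = (undefined :: 'n)"
  define D where "D = \<bar>K\<bar> + \<bar>B i0\<bar> + \<mu> i0 * (?C * b)"
  have S: "\<bar>1 \<bullet> x\<bar> \<le> D" if x: "x \<in> P" for x
  proof -
    define e f where "e = \<mu> i0 * (x $ i0 - ?m x)" and "f = \<mu> i0 * (?C * b)"
    have "\<mu> i0 * (- (?C * b)) \<le> e"
      unfolding e_def using absdev[OF x, of i0] \<mu>[of i0] by (intro mult_left_mono) auto
    then have "- f \<le> e" by (simp add: f_def)
    moreover have "0 \<le> ?C * b" using absdev[OF x, of i0] by linarith
    then have "0 \<le> f" unfolding f_def using \<mu>[of i0] by simp
    moreover have "1 \<bullet> x + e \<le> B i0" unfolding e_def by (rule B'[OF x])
    moreover have "D = \<bar>K\<bar> + \<bar>B i0\<bar> + f" by (simp add: D_def f_def)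
    ultimately show ?thesis using low[OF x] by linarith
  qed
  have "norm x \<le> (\<Sum>i\<in>(UNIV :: 'n set). D + ?C * b)" if x: "x \<in> P" for x
  proof -
    have "\<bar>x $ i\<bar> \<le> D + ?C * b" for i
    proof -
      have "\<bar>?m x\<bar> = \<bar>1 \<bullet> x\<bar> / ?C" by simp
      also have "\<dots> \<le> \<bar>1 \<bullet> x\<bar> / 1" by (intro divide_left_mono) (auto simp: Suc_le_eq)
      also have "\<dots> \<le> D" using S[OF x] by simp
      finally show ?thesis using absdev[OF x, of i] by linarith
    qed
    then show ?thesis by (intro order_trans[OF norm_le_l1_cart] sum_mono)
  qed
  then show ?thesis by (rule boundedI)
qed

lemma bij_betw_through:
  fixes i :: "'n::finite"
  assumes "CARD('n) = Suc (Suc j)"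
  obtains g where "bij_betw g {..Suc j} (UNIV :: 'n set)" "g j = i"
proof -
  obtain h where h: "bij_betw h {..Suc j} (UNIV :: 'n set)"
    using finite_same_card_bij[of "{..Suc j}" "UNIV :: 'n set"] assms by auto
  have "bij_betw (Transposition.transpose (h j) i \<circ> h) {..Suc j} UNIV"
    by (rule bij_betw_trans[OF h]) simp
  then show ?thesis by (rule that) simp
qed

text \<open>Taken relative to the full system \<open>S\<close>, exposure passes to every polytope
  inside \<open>S\<close> that still contains \<open>v\<close>, in particular after cuts.\<close>

definition shadow_exposed :: "'a::real_inner set \<Rightarrow> 'a \<Rightarrow> 'a \<Rightarrow> 'a \<Rightarrow> bool" where
  "shadow_exposed S w c v \<longleftrightarrow>
     (\<exists>\<mu>\<ge>0. \<forall>x\<in>S. (w + \<mu> *\<^sub>R c) \<bullet> x \<le> (w + \<mu> *\<^sub>R c) \<bullet> v \<and>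
        ((w + \<mu> *\<^sub>R c) \<bullet> x = (w + \<mu> *\<^sub>R c) \<bullet> v \<longrightarrow> x = v))"

lemma shadow_exposed_imp_shadow_vertex:
  assumes "shadow_exposed S w c v" "v \<in> P" "P \<subseteq> S"
  shows "v \<in> shadow_vertices P w c"
proof -
  obtain \<mu> where \<mu>: "\<mu> \<ge> 0" "\<And>x. x \<in> P \<Longrightarrow> (w + \<mu> *\<^sub>R c) \<bullet> x \<le> (w + \<mu> *\<^sub>R c) \<bullet> v"
    "\<And>x. x \<in> P \<Longrightarrow> (w + \<mu> *\<^sub>R c) \<bullet> x = (w + \<mu> *\<^sub>R c) \<bullet> v \<Longrightarrow> x = v"
    using assms unfolding shadow_exposed_def subset_iff by (elim exE conjE) (rule that; blast)
  have "maximizers P (w + \<mu> *\<^sub>R c) = {v}"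
  proof
    show "maximizers P (w + \<mu> *\<^sub>R c) \<subseteq> {v}"
    proof
      fix x assume "x \<in> maximizers P (w + \<mu> *\<^sub>R c)"
      then have x: "x \<in> P" "(w + \<mu> *\<^sub>R c) \<bullet> v \<le> (w + \<mu> *\<^sub>R c) \<bullet> x"
        using assms(2) by (simp_all add: maximizers_def)
      then have "x = v" using \<mu>(2)[OF x(1)] \<mu>(3)[OF x(1)] by linarith
      then show "x \<in> {v}" by simp
    qed
    show "{v} \<subseteq> maximizers P (w + \<mu> *\<^sub>R c)"
      unfolding maximizers_def using \<mu>(2) assms(2) by blast
  qed
  then show ?thesis unfolding shadow_vertices_def using \<mu>(1) by blast
qed

text \<open>\<open>W\<close> depends on \<open>c\<close>: it is the plate of a largest entry of
  \<open>c\<close>. The strict point \<open>p\<close> below all of \<open>V\<close> is what cutting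
  off vertices requires.\<close>

lemma plate_arrangement_exists:
  assumes card: "CARD('n::finite) = Suc (Suc j)"
  shows "\<exists>(H :: ((real ^ 'n) \<times> real) set) p V.
     finite H \<and> card H \<le> CARD('n) * (2 * Suc j) + 1 \<and> strictly H p \<and> bounded (halfspaces H) \<and>
     finite V \<and> V \<subseteq> halfspaces H \<and> (\<forall>v\<in>V. 1 \<bullet> p < 1 \<bullet> v) \<and>
     (\<forall>c. c \<noteq> 0 \<and> c \<bullet> 1 = 0 \<longrightarrow>
        (\<exists>W\<subseteq>V. card W = 2 ^ j \<and>
           (\<forall>v\<in>W. shadow_exposed (halfspaces H) 1 c v)))"
proof -
  let ?C = "real CARD('n)"
  obtain T :: "((nat \<Rightarrow> real) \<times> real) set" and V0 :: "(real \<times> (nat \<Rightarrow> real)) set"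
    where TV: "finite T \<and> card T \<le> 2 * Suc j \<and> (\<forall>(n, b)\<in>T. - 2 \<le> n j) \<and> finite V0 \<and> card V0 = 2 ^ j \<and>
     (\<forall>(z, y)\<in>V0. satisfies j T z y \<and> (\<forall>k>j. y k = 0) \<and>
        (\<exists>s \<delta>. \<bar>s\<bar> < 1 \<and> \<delta> > 0 \<and> exposed_near j T s \<delta> z y))"
    using gadget_exists[of j] by (elim exE)
  then have T: "finite T" "card T \<le> 2 * Suc j" and V0: "finite V0" "card V0 = 2 ^ j"
    by (simp_all only:)
  have nj: "- 2 \<le> n j" if "(n, b) \<in> T" for n b
    using bspec[OF TV[THEN conjunct2, THEN conjunct2, THEN conjunct1] that] unfolding case_prod_conv .
  have v: "satisfies j T z y \<and> (\<forall>k>j. y k = 0) \<and>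
        (\<exists>s \<delta>. \<bar>s\<bar> < 1 \<and> \<delta> > 0 \<and> exposed_near j T s \<delta> z y)" if "(z, y) \<in> V0" for z y
    using bspec[OF TV[THEN conjunct2, THEN conjunct2, THEN conjunct2, THEN conjunct2, THEN conjunct2] that]
    unfolding case_prod_conv .
  have "\<forall>p\<in>V0. \<exists>s \<delta>. \<bar>s\<bar> < 1 \<and> \<delta> > 0 \<and> exposed_near j T s \<delta> (fst p) (snd p)"
    using v by (metis prod.collapse)
  then obtain s \<delta> where s: "\<And>p. p \<in> V0 \<Longrightarrow> \<bar>s p\<bar> < 1" "\<And>p. p \<in> V0 \<Longrightarrow> \<delta> p > 0"
      "\<And>p. p \<in> V0 \<Longrightarrow> exposed_near j T (s p) (\<delta> p) (fst p) (snd p)"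
    by metis
  \<comment> \<open>A sum of nonnegative terms dominates each of them; \<open>R\<close> and
    \<open>m\<close> below use the same device.\<close>
  define L where "L = 1 + (\<Sum>p\<in>V0. 4 * ?C / \<delta> p)"
  have L: "L > 0" unfolding L_def using s(2) by (intro add_pos_nonneg sum_nonneg) (auto simp: less_imp_le)
  have large: "4 * ?C \<le> \<delta> p * L" if p: "p \<in> V0" for p
  proof -
    have "4 * ?C / \<delta> p \<le> (\<Sum>p\<in>V0. 4 * ?C / \<delta> p)"
      using s(2) V0(1) p by (intro member_le_sum) (auto simp: less_imp_le)
    then have "4 * ?C / \<delta> p \<le> L" by (simp add: L_def)
    then show ?thesis using s(2)[OF p] by (simp add: pos_divide_le_eq mult.commute)
  qed
  define R where "R = (\<Sum>h\<in>T. \<Sum>k<j. \<bar>fst h k - 1\<bar>)"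
  have R0: "R \<ge> 0" unfolding R_def by (intro sum_nonneg) auto
  have R: "\<bar>n k - 1\<bar> \<le> R" if "(n, b) \<in> T" "k < j" for n b k
  proof -
    have "\<bar>n k - 1\<bar> \<le> (\<Sum>k<j. \<bar>fst (n, b) k - 1\<bar>)"
      using that member_le_sum[of k "{..<j}" "\<lambda>k. \<bar>n k - 1\<bar>"] by auto
    also have "\<dots> \<le> R" unfolding R_def using T that
      by (intro member_le_sum[of "(n, b)" T "\<lambda>h. \<Sum>k<j. \<bar>fst h k - 1\<bar>"]) (auto intro: sum_nonneg)
    finally show ?thesis .
  qed
  \<comment> \<open>The radii are powers of \<open>M\<close> with distinct exponents, so any two
    differ at least by the factor that the separation of plates asks for.\<close>
  define M where "M = 2 * (real j * (R * L)) + 1"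
  have M: "M \<ge> 1" using R0 L by (simp add: M_def)
  obtain idx :: "'n \<Rightarrow> nat" where idx: "inj idx"
    using finite_imp_inj_to_nat_seg[of "UNIV :: 'n set"] by auto
  define r where "r i = M ^ idx i" for i
  have r: "r i > 0" for i using M by (simp add: r_def)
  have far: "2 * (real j * (R * L)) * r m \<le> r i \<or> 2 * (real j * (R * L)) * r i \<le> r m" if "i \<noteq> m" for i m
  proof -
    have *: "2 * (real j * (R * L)) * r a \<le> r b" if "idx a < idx b" for a b
    proof -
      have "2 * (real j * (R * L)) * r a \<le> M * r a"
        using r[of a] by (intro mult_right_mono) (auto simp: M_def)
      also have "\<dots> = M ^ Suc (idx a)" by (simp add: r_def)
      also have "\<dots> \<le> r b" unfolding r_def using that M by (intro power_increasing) auto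
      finally show ?thesis .
    qed
    have "idx i \<noteq> idx m" using idx that by (auto dest: injD)
    then show ?thesis using *[of i m] *[of m i] by linarith
  qed
  have "\<forall>i. \<exists>g. bij_betw g {..Suc j} (UNIV :: 'n set) \<and> g j = i"
    using bij_betw_through[OF card] by metis
  then obtain g where g: "\<And>i. bij_betw (g i) {..Suc j} (UNIV :: 'n set)" "\<And>i. g i j = i"
    by metis
  define X where "X \<epsilon> i p = plate_point (g i) j L (r i) (\<epsilon> * fst p) (\<lambda>k. \<epsilon> * snd p k)" for \<epsilon> i p
  \<comment> \<open>At \<open>\<epsilon> = 0\<close> the origin satisfies every plate constraint
    strictly, because \<open>n j \<ge> - 2\<close>.\<close>
  have off: "0 < - plate_offset j (r i) n" if "(n, b) \<in> T" for n b i
  proof -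
    have "- plate_offset j (r i) n = (n j + 5/2) * (r i)\<^sup>2"
      by (simp add: plate_offset_def algebra_simps)
    also have "\<dots> > 0" using nj[OF that] r[of i] by (intro mult_pos_pos) auto
    finally show ?thesis .
  qed
  define separated where "separated \<epsilon> \<longleftrightarrow> (\<forall>i\<in>UNIV. \<forall>m\<in>UNIV - {i}. \<forall>h\<in>T. \<forall>p\<in>V0.
      plate_normal (g m) j L (r m) (fst h) \<bullet> X \<epsilon> i p + plate_offset j (r m) (fst h) - \<epsilon> * snd h < 0)" for \<epsilon>
  define origin_inside where "origin_inside \<epsilon> \<longleftrightarrow>
      (\<forall>i\<in>UNIV. \<forall>h\<in>T. 0 < \<epsilon> * snd h - plate_offset j (r i) (fst h))" for \<epsilon>
  \<comment> \<open>Finitely many strict inequalities, each true in the limit, hold together for all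
    small \<open>\<epsilon>\<close>.\<close>
  have "eventually separated (at_right 0)"
    unfolding separated_def
  proof (intro eventually_ball_finite ballI)
    fix i m :: 'n and h p assume m: "m \<in> UNIV - {i}" and h: "h \<in> T" and p: "p \<in> V0"
    obtain n b where nb: "h = (n, b)" by fastforce
    have "((\<lambda>\<epsilon>. plate_normal (g m) j L (r m) n \<bullet> X \<epsilon> i p + plate_offset j (r m) n - \<epsilon> * b)
        \<longlongrightarrow> plate_normal (g m) j L (r m) n \<bullet> plate_point (g i) j L (r i) 0 (\<lambda>_. 0)
             + plate_offset j (r m) n - 0 * b) (at_right 0)"
      unfolding X_def by (intro tendsto_intros tendsto_plate_point)
    moreover have "plate_normal (g m) j L (r m) n \<bullet> plate_point (g i) j L (r i) 0 (\<lambda>_. 0)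
             + plate_offset j (r m) n < 0"
      using m h nb nj R R0 L r far[of i m] g(2)
      by (intro other_plate_strict[OF g(1) g(1), where R = R]) auto
    ultimately show "eventually (\<lambda>\<epsilon>. plate_normal (g m) j L (r m) (fst h) \<bullet> X \<epsilon> i p
        + plate_offset j (r m) (fst h) - \<epsilon> * snd h < 0) (at_right 0)"
      unfolding nb by (intro order_tendstoD(2)) auto
  qed (use T V0 in auto)
  moreover have "eventually origin_inside (at_right 0)"
    unfolding origin_inside_def
  proof (intro eventually_ball_finite ballI)
    fix i h assume h: "h \<in> T"
    obtain n b where nb: "h = (n, b)" by fastforce
    have "((\<lambda>\<epsilon>. \<epsilon> * b - plate_offset j (r i) n) \<longlongrightarrow> 0 * b - plate_offset j (r i) n) (at_right 0)"
      by (intro tendsto_intros)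
    then show "eventually (\<lambda>\<epsilon>. 0 < \<epsilon> * snd h - plate_offset j (r i) (fst h)) (at_right 0)"
      unfolding nb using off[of n b i] h nb by (intro order_tendstoD(1)) auto
  qed (use T in auto)
  moreover have "eventually (\<lambda>\<epsilon>. \<epsilon> > (0::real)) (at_right 0)" by (rule eventually_at_right_less)
  ultimately have "eventually (\<lambda>\<epsilon>. \<epsilon> > 0 \<and> separated \<epsilon> \<and> origin_inside \<epsilon>) (at_right 0)"
    by (intro eventually_conj)
  then have "\<exists>\<epsilon>. \<epsilon> > 0 \<and> separated \<epsilon> \<and> origin_inside \<epsilon>"
    by (rule eventually_happens'[OF trivial_limit_at_right_real])
  then obtain \<epsilon> where \<epsilon>: "\<epsilon> > 0" "separated \<epsilon>" "origin_inside \<epsilon>" by (elim exE conjE)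
  have zero: "0 < \<epsilon> * snd h - plate_offset j (r i) (fst h)" if "h \<in> T" for i h
    using \<epsilon>(3) that unfolding origin_inside_def by blast
  have other: "plate_normal (g m) j L (r m) (fst h) \<bullet> X \<epsilon> i p + plate_offset j (r m) (fst h) - \<epsilon> * snd h < 0"
    if "m \<noteq> i" "h \<in> T" "p \<in> V0" for i m h p
    using \<epsilon>(2) that unfolding separated_def by blast
  define V where "V = (\<lambda>(i, p). X \<epsilon> i p) ` (UNIV \<times> V0)"
  have V: "finite V" using V0 by (simp add: V_def)
  \<comment> \<open>Coordinate sums on \<open>V\<close> lie above \<open>- m\<close> and the
    bounding constraint sits at \<open>- 2 * m\<close>; \<open>q\<close> is placed between them, at
    \<open>- (3 * m / 2)\<close>.\<close>
  define m where "m = 1 + (\<Sum>v\<in>V. \<bar>1 \<bullet> v\<bar>)"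
  have m0: "m > 0" unfolding m_def by (intro add_pos_nonneg sum_nonneg) auto
  have Vm: "- m < 1 \<bullet> v" if "v \<in> V" for v
  proof -
    have "\<bar>1 \<bullet> v\<bar> \<le> (\<Sum>v\<in>V. \<bar>1 \<bullet> v\<bar>)" using V that by (intro member_le_sum) auto
    then show ?thesis by (simp add: m_def)
  qed
  define Hp where "Hp i = plate_constraints (g i) j L (r i) \<epsilon> T" for i
  define H where "H = insert (- 1, 2 * m) (\<Union>i. Hp i)"
  have fHp: "finite (Hp i)" "card (Hp i) \<le> 2 * Suc j" for i
  proof -
    show "finite (Hp i)" using T by (simp add: Hp_def plate_constraints_def)
    have "card (Hp i) \<le> card T" unfolding Hp_def plate_constraints_def using T by (intro card_image_le)
    then show "card (Hp i) \<le> 2 * Suc j" using T by simp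
  qed
  have fH: "finite H" using fHp by (simp add: H_def)
  have cH: "card H \<le> CARD('n) * (2 * Suc j) + 1"
  proof -
    have "card (\<Union>i. Hp i) \<le> (\<Sum>i\<in>UNIV. card (Hp i))" by (intro card_UN_le) simp
    also have "\<dots> \<le> (\<Sum>i\<in>(UNIV :: 'n set). 2 * Suc j)" using fHp by (intro sum_mono) auto
    finally have "card (\<Union>i. Hp i) \<le> CARD('n) * (2 * Suc j)" by simp
    moreover have "card H \<le> Suc (card (\<Union>i. Hp i))"
      using fHp by (simp add: H_def card_insert_if)
    ultimately show ?thesis by linarith
  qed
  have HpH: "halfspaces H \<subseteq> halfspaces (Hp i)" for i by (rule halfspaces_mono) (auto simp: H_def)
  have VH: "V \<subseteq> halfspaces H"
  proof
    fix v assume vV: "v \<in> V"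
    then obtain i p where p: "p \<in> V0" "v = X \<epsilon> i p" unfolding V_def by auto
    have "fst h \<bullet> v \<le> snd h" if h: "h \<in> Hp a" for h a
    proof (cases "a = i")
      case True
      have "satisfies j T (fst p) (snd p)" using v[of "fst p" "snd p"] p by simp
      then have "v \<in> halfspaces (Hp i)"
        unfolding p(2) X_def Hp_def by (rule plate_point_mem[OF g(1) L r \<epsilon>(1)])
      then show ?thesis using h True by (simp add: halfspaces_def)
    next
      case False
      obtain t where "t \<in> T" "h = (plate_normal (g a) j L (r a) (fst t), \<epsilon> * snd t - plate_offset j (r a) (fst t))"
        using h unfolding Hp_def plate_constraints_def by auto
      then show ?thesis using other[OF False _ p(1), of t] p(2) by simp
    qed
    moreover have "(- 1) \<bullet> v \<le> 2 * m" using Vm[OF vV] m0 by simp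
    ultimately show "v \<in> halfspaces H" unfolding halfspaces_def H_def by auto
  qed
  define q :: "real ^ 'n" where "q = (- (3 * m / (2 * ?C))) *\<^sub>R 1"
  have one1: "(1 :: real ^ 'n) \<bullet> 1 = ?C" by (simp add: one_inner_vec)
  have q1: "1 \<bullet> q = - (3 * m / 2)" by (simp add: q_def one1)
  have sq: "strictly H q"
    unfolding strictly_def
  proof
    fix h assume "h \<in> H"
    then consider "h = (- 1, 2 * m)" | i where "h \<in> Hp i" unfolding H_def by blast
    then show "fst h \<bullet> q < snd h"
    proof cases
      case 1
      then show ?thesis using q1 m0 by simp
    next
      case 2
      then obtain t where t: "t \<in> T" "h = (plate_normal (g i) j L (r i) (fst t), \<epsilon> * snd t - plate_offset j (r i) (fst t))"
        unfolding Hp_def plate_constraints_def by auto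
      \<comment> \<open>All plate normals have the same positive inner product with
        \<open>1\<close>, so descending from the origin along \<open>1\<close> stays strictly
        inside.\<close>
      have "plate_normal (g i) j L (r i) (fst t) \<bullet> 1 = ?C"
        by (simp add: plate_normal_inner plate_y_def power2_eq_square)
      then have "plate_normal (g i) j L (r i) (fst t) \<bullet> q = - (3 * m / 2)" by (simp add: q_def)
      then show ?thesis using zero[OF t(1), of i] m0 t(2) by simp
    qed
  qed
  have exposed: "\<exists>\<mu>>0. \<forall>x\<in>halfspaces H. (1 + \<mu> *\<^sub>R c) \<bullet> x \<le> (1 + \<mu> *\<^sub>R c) \<bullet> X \<epsilon> i p \<and>
           ((1 + \<mu> *\<^sub>R c) \<bullet> x = (1 + \<mu> *\<^sub>R c) \<bullet> X \<epsilon> i p \<longrightarrow> x = X \<epsilon> i p)"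
    if "p \<in> V0" "(\<Sum>i\<in>UNIV. c $ i) = 0" "c \<noteq> 0" "\<And>k. c $ k \<le> c $ i" for p i c
  proof -
    have "c $ k \<le> c $ g i j" for k using that(4) g(2) by simp
    from plate_point_exposed[OF g(1) L r[of i] \<epsilon>(1) s(3)[OF that(1)] s(1)[OF that(1)] s(2)[OF that(1)]
        large[OF that(1)] that(2,3) this]
    show ?thesis using HpH[of i] unfolding X_def Hp_def by blast
  qed
  have "bounded (halfspaces H)"
  proof (rule bounded_by_tilted_objectives)
    show "- (2 * m) \<le> 1 \<bullet> x" if "x \<in> halfspaces H" for x
    proof -
      have "(- 1) \<bullet> x \<le> 2 * m" using that by (simp add: halfspaces_def H_def)
      then show ?thesis by simp
    qed
    fix i :: 'n
    \<comment> \<open>A tilt with sum 0 whose largest entry is at \<open>i\<close>: the value at any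
      point of plate \<open>i\<close> is then an upper bound.\<close>
    let ?c = "axis i 1 - (1 / ?C) *\<^sub>R 1 :: real ^ 'n"
    have "V0 \<noteq> {}" using V0(2) by auto
    then obtain p where p: "p \<in> V0" by blast
    have "(\<Sum>k\<in>UNIV. ?c $ k) = 0" by (simp add: sum_subtractf axis_def)
    moreover have "?c \<noteq> 0"
    proof -
      have "?c $ i \<noteq> 0" using card by (simp add: axis_def)
      then show ?thesis by (metis zero_index)
    qed
    moreover have "?c $ k \<le> ?c $ i" for k by (simp add: axis_def)
    ultimately obtain \<mu> where "\<mu> > 0" "\<forall>x\<in>halfspaces H. (1 + \<mu> *\<^sub>R ?c) \<bullet> x \<le> (1 + \<mu> *\<^sub>R ?c) \<bullet> X \<epsilon> i p"
      using exposed[OF p, of ?c i] by blast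
    then show "\<exists>\<mu>>0. \<exists>B. \<forall>x\<in>halfspaces H. (1 + \<mu> *\<^sub>R ?c) \<bullet> x \<le> B" by blast
  qed
  moreover have "1 \<bullet> q < 1 \<bullet> v" if "v \<in> V" for v using Vm[OF that] m0 q1 by simp
  moreover have "\<exists>W\<subseteq>V. card W = 2 ^ j \<and>
           (\<forall>v\<in>W. shadow_exposed (halfspaces H) 1 c v)"
    if c: "c \<noteq> 0 \<and> c \<bullet> 1 = 0" for c
  proof -
    have "Max (range (\<lambda>k. c $ k)) \<in> range (\<lambda>k. c $ k)" by (intro Max_in) auto
    then obtain i where i: "Max (range (\<lambda>k. c $ k)) = c $ i" by blast
    have max: "c $ k \<le> c $ i" for k unfolding i[symmetric] by (intro Max_ge) auto
    have sum: "(\<Sum>i\<in>UNIV. c $ i) = 0" using c by (simp add: inner_commute[of c] one_inner_vec)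
    have "inj_on (X \<epsilon> i) V0"
    proof -
      have "inj_on (\<lambda>(z, y). plate_point (g i) j L (r i) (\<epsilon> * z) (\<lambda>k. \<epsilon> * y k)) V0"
        by (rule plate_points_inj[OF g(1) L r \<epsilon>(1)]) (use v in blast)
      then show ?thesis by (simp add: X_def case_prod_unfold inj_on_def)
    qed
    then have "card (X \<epsilon> i ` V0) = 2 ^ j" using V0 by (simp add: card_image)
    moreover have "X \<epsilon> i ` V0 \<subseteq> V" unfolding V_def by force
    moreover have "shadow_exposed (halfspaces H) 1 c v" if vi: "v \<in> X \<epsilon> i ` V0" for v
    proof -
      obtain p where p: "p \<in> V0" "v = X \<epsilon> i p" using vi by blast
      show ?thesis
        using exposed[OF p(1) sum _ max] c unfolding p(2) shadow_exposed_def by (meson less_imp_le)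
    qed
    ultimately show ?thesis by blast
  qed
  ultimately show ?thesis
    using fH cH sq V VH by (intro exI[of _ H] exI[of _ q] exI[of _ V]) blast
qed

theorem corollary1p3:
  fixes d :: nat
  assumes "d \<ge> 3" and "CARD('n::finite) = d + 1"
  shows "\<exists>(P :: (real ^ 'n) set) (w :: real ^ 'n).
           polytope P \<and> aff_dim P = int (d + 1) \<and>
           card {F. F facet_of P} = (2 * d + 1) * (d + 1) + 1 \<and>
           w \<noteq> 0 \<and>
           (\<forall>c :: real ^ 'n. c \<noteq> 0 \<and> c \<bullet> w = 0 \<longrightarrow>
              (\<forall>vs. shadow_path P w c vs \<longrightarrow> path_length vs \<ge> 2 ^ (d - 1) - 1))"
proof -
  \<comment> \<open>The dimension is \<open>j + 2\<close>, and the \<open>2 ^ j\<close> points of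
    one plate, all on the path, account for at least \<open>2 ^ j - 1\<close> edges.\<close>
  define j where "j = d - 1"
  have d: "d = Suc j" using assms(1) by (simp add: j_def)
  have card: "CARD('n) = Suc (Suc j)" using assms(2) d by simp
  obtain H :: "((real ^ 'n) \<times> real) set" and p V where HV:
     "finite H \<and> card H \<le> CARD('n) * (2 * Suc j) + 1 \<and> strictly H p \<and> bounded (halfspaces H) \<and>
     finite V \<and> V \<subseteq> halfspaces H \<and> (\<forall>v\<in>V. 1 \<bullet> p < 1 \<bullet> v) \<and>
     (\<forall>c. c \<noteq> 0 \<and> c \<bullet> 1 = 0 \<longrightarrow>
        (\<exists>W\<subseteq>V. card W = 2 ^ j \<and> (\<forall>v\<in>W. shadow_exposed (halfspaces H) 1 c v)))"
    using plate_arrangement_exists[OF card] by (elim exE)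
  then have H: "finite H" "card H \<le> CARD('n) * (2 * Suc j) + 1" "strictly H p" "bounded (halfspaces H)"
    and V: "finite V" "V \<subseteq> halfspaces H" "\<And>v. v \<in> V \<Longrightarrow> 1 \<bullet> p < 1 \<bullet> v"
    by blast+
  \<comment> \<open>The arrangement has at most \<open>2 * d * (d + 1) + 1\<close> constraints;
    \<open>polytope_with_facets\<close> makes up the difference.\<close>
  have "card H \<le> (2 * d + 1) * (d + 1) + 1"
    using H(2) unfolding card d by (simp add: algebra_simps)
  moreover have "2 \<le> DIM(real ^ 'n)" using card by simp
  ultimately obtain P where P: "polytope P" "aff_dim P = int DIM(real ^ 'n)"
    "card {F. F facet_of P} = (2 * d + 1) * (d + 1) + 1" "V \<subseteq> P" "P \<subseteq> halfspaces H"
    using polytope_with_facets[OF H(1,3,4) _ V] by blast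
  have "path_length vs \<ge> 2 ^ (d - 1) - 1"
    if c: "c \<noteq> 0 \<and> c \<bullet> 1 = 0" and path: "shadow_path P 1 c vs" for c vs
  proof -
    have "\<exists>W. W \<subseteq> V \<and> card W = 2 ^ j \<and> (\<forall>v\<in>W. shadow_exposed (halfspaces H) 1 c v)"
      using HV c by simp
    then obtain W where "W \<subseteq> V \<and> card W = 2 ^ j \<and> (\<forall>v\<in>W. shadow_exposed (halfspaces H) 1 c v)"
      by (elim exE)
    then have W: "W \<subseteq> V" "card W = 2 ^ j" "\<And>v. v \<in> W \<Longrightarrow> shadow_exposed (halfspaces H) 1 c v"
      by simp_all
    have "W \<subseteq> shadow_vertices P 1 c"
      using shadow_exposed_imp_shadow_vertex[OF W(3) _ P(5)] W(1) P(4) by blast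
    also have "\<dots> \<subseteq> set vs" by (rule shadow_path_contains_shadow_vertices[OF path])
    finally have "card W \<le> card (set vs)" by (intro card_mono) auto
    also have "\<dots> \<le> length vs" by (rule card_length)
    finally show ?thesis unfolding path_length_def W(2) j_def by simp
  qed
  moreover have "aff_dim P = int (d + 1)" using P(2) assms(2) by simp
  moreover have "(1 :: real ^ 'n) \<noteq> 0" by simp
  ultimately show ?thesis using P(1,3) by (intro exI[of _ P] exI[of _ "1 :: real ^ 'n"]) blast
qed

end
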